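(* Let $1\le p<\infty$ and $d\ge 3$. There exist $\eta>0$, $c>0$ and $\epsilon_0\in(0,1)$ such that for all $0<\epsilon<\epsilon_0$, $$\log N(\epsilon,p,d)\ \ge\ c\,\epsilon^{-1}\,(\log 1/\epsilon)^{d-1+\eta}.$$
   Context: For $f\in L^p([0,1]^d)$ set $\operatorname{Int}_d f(x_1,\dots,x_d)=\int_0^{x_1}\cdots\int_0^{x_d}f(y_1,\dots,y_d)\,dy_1\cdots dy_d$, which is a function in $C([0,1]^d)$. Let $\operatorname{Ball}(MW^p([0,1]^d))=\operatorname{Int}_d\bigl(\{f\in L^p([0,1]^d):\|f\|_p\le1\}\bigr)$. For $0<\epsilon<1$, $N(\epsilon,p,d)$ is the least number $N$ of points $x_1,\dots,x_N\in C([0,1]^d)$ such that $\operatorname{Ball}(MW^p([0,1]^d))\subset\bigcup_{m=1}^N(x_m+\epsilon B_\infty)$, where $B_\infty$ is the unit ball of $C([0,1]^d)$ in the sup norm (with $N(\epsilon,p,d)=\infty$ if there is no finite such $N$). *)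

theory Defs
  imports "HOL-Analysis.Analysis"
begin

text \<open>
  The dimension \<open>d\<close> is \<open>CARD('n)\<close>. Functions on the cube are represented by total functions on
  \<open>real ^ 'n\<close>; none of the notions below constrains their values outside the cube.
\<close>

abbreviation unit_cube :: "(real ^ 'n) set" where
  "unit_cube \<equiv> cbox 0 1"

definition Lp_space :: "real \<Rightarrow> (real ^ 'n \<Rightarrow> real) set" where
  "Lp_space p = {f. f \<in> borel_measurable (lebesgue_on unit_cube) \<and>
                    integrable (lebesgue_on unit_cube) (\<lambda>x. \<bar>f x\<bar> powr p)}"

definition Lp_norm :: "real \<Rightarrow> (real ^ 'n \<Rightarrow> real) \<Rightarrow> real" where
  "Lp_norm p f = (LINT x | lebesgue_on unit_cube. \<bar>f x\<bar> powr p) powr (1 / p)"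

text \<open>
  The \<open>d\<close>-fold integral from \<open>0\<close> to \<open>x\<^sub>i\<close> in each variable is written as one Lebesgue integral over
  the box \<open>[0,x\<^sub>1] \<times> \<dots> \<times> [0,x\<^sub>d]\<close>. It is only meaningful for \<open>x\<close> in the cube.
\<close>

definition Int_op :: "(real ^ 'n \<Rightarrow> real) \<Rightarrow> real ^ 'n \<Rightarrow> real" where
  "Int_op f x = (LINT y | lebesgue_on (cbox 0 x). f y)"

definition Ball_MW :: "real \<Rightarrow> (real ^ 'n \<Rightarrow> real) set" where
  "Ball_MW p = Int_op ` {f \<in> Lp_space p. Lp_norm p f \<le> 1}"

definition C_cube :: "(real ^ 'n \<Rightarrow> real) set" where
  "C_cube = {g. continuous_on unit_cube g}"

definition sup_norm :: "(real ^ 'n \<Rightarrow> real) \<Rightarrow> real" where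
  "sup_norm g = (SUP t\<in>unit_cube. \<bar>g t\<bar>)"

definition B_inf :: "(real ^ 'n \<Rightarrow> real) set" where
  "B_inf = {g \<in> C_cube. sup_norm g \<le> 1}"

text \<open>
  The type argument carries the dimension. Since \<open>Inf {} = \<infinity>\<close> in \<^typ>\<open>enat\<close>, the value is \<open>\<infinity>\<close>
  if no finite cover exists.
\<close>

definition covering_number :: "real \<Rightarrow> real \<Rightarrow> 'n::finite itself \<Rightarrow> enat" where
  "covering_number \<epsilon> p _ =
     Inf {enat N | N. \<exists>x :: nat \<Rightarrow> real ^ 'n \<Rightarrow> real.
            (\<forall>m\<in>{1..N}. x m \<in> C_cube) \<and>
            Ball_MW p \<subseteq> (\<Union>m\<in>{1..N}. (\<lambda>b t. x m t + \<epsilon> * b t) ` B_inf)}"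

definition ln_enat :: "enat \<Rightarrow> ereal" where
  "ln_enat n = (case n of enat m \<Rightarrow> if m = 0 then - \<infinity> else ereal (ln (real m)) | \<infinity> \<Rightarrow> \<infinity>)"

end

(*
  Consider the d-dimensional 4-adic boxes R of volume 4^-n, with n = d q. On each put a bounded
  function f_R whose d-fold integral 4^-n u_R is supported in R. Random signs alpha give functions
  f = sum alpha_R f_R whose L^p norms are of order sqrt m, where m = q^(d-1) is the number of shapes
  of boxes, so it suffices to show that ||sum gamma_R u_R||_oo >= c sqrt (m q) for all gamma in
  {-1,0,1}^T with large support, where T contains half of the boxes: the entropy bound with
  eta = 1/2 then follows by counting.

  There are signs k_R, supported in R, with <u_R, k_R'> = 0 for R' different from R. For random
  beta test against the Riesz product g = prod_R (1 + delta beta_R k_R), which is nonnegative with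
  expected integral 1. Since two random points of a box R lie in only few further common boxes, the
  coefficient <g, u_R> has second moment close to the square of its correlation with beta_R as long
  as delta^2 is at most of order q / m. So for most beta all these coefficients together are close
  in l^2 to a multiple of beta, and the Sauer-Shelah lemma provides a set T on which every sign
  pattern extends to such a beta. Testing sum gamma_R u_R against g for a beta which extends gamma
  gives the lower bound delta m, up to a constant.
*)
theory Submission
  imports Defs
begin

section \<open>Shattering and sums over random signs\<close>

text \<open>For all boxes at once and arbitrary signs, the lower bound would be a signed small ball
  inequality of order \<open>q ^ (d/2)\<close>, and a Riesz product reproduces only typical
  patterns. Entropy needs just a large family of separated functions, so any set \<open>T\<close>
  with a fixed share of the boxes will do; this freedom is what shattering exploits.

  Orthogonality alone would give \<open>sqrt m\<close>, which only balances the norm of the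
  functions and leads to the exponent \<open>d - 1\<close>. The test with the Riesz product gains
  \<open>sqrt q\<close> over this, hence \<eta> = 1/2.

  The restriction \<open>d >= 3\<close> comes from comparing a main term \<delta> with an
  \<open>l^2\<close> error of order \<open>\<delta>^2\<close> per coefficient: with
  \<open>\<delta>^2\<close> of order \<open>q / m = q ^ (2 - d)\<close> the error is smaller only if
  \<delta> tends to 0.

  Base 4 serves twice. Four pieces are needed for a sign pattern that annihilates affine functions,
  and pairs of points that agree on \<open>e\<close> further levels are rarer by
  \<open>4 ^ e\<close>, which beats the growth of the second moment, at most of order
  \<open>2 ^ e\<close>.\<close>

definition shatters :: "'a set set \<Rightarrow> 'a set \<Rightarrow> bool" where
  "shatters F T \<longleftrightarrow> (\<forall>S\<subseteq>T. \<exists>A\<in>F. A \<inter> T = S)"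

lemma card_le_card_shattered:
  assumes "finite U" "F \<subseteq> Pow U"
  shows "card F \<le> card {T. T \<subseteq> U \<and> shatters F T}"
  using assms
proof (induction U arbitrary: F rule: finite_induct)
  case empty
  show ?case
  proof (cases "F = {}")
    case False
    with empty have "F = {{}}" by (simp add: subset_singleton_iff)
    then have "{T. T \<subseteq> {} \<and> shatters F T} = {{}}" by (auto simp: shatters_def)
    then show ?thesis using \<open>F = {{}}\<close> by simp
  qed simp
next
  case (insert a U)
  define F0 where "F0 = {A\<in>F. a \<notin> A}"
  define F1 where "F1 = {A. a \<notin> A \<and> insert a A \<in> F}"
  have sub: "F0 \<subseteq> Pow U" "F1 \<subseteq> Pow U"
    using insert.prems insert.hyps by (auto simp: F0_def F1_def)
  have fin: "finite F0" "finite F1"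
    using sub insert.hyps(1) by (auto intro: finite_subset)
  have F: "F = F0 \<union> insert a ` F1"
  proof
    show "F \<subseteq> F0 \<union> insert a ` F1"
    proof
      fix A assume A: "A \<in> F"
      show "A \<in> F0 \<union> insert a ` F1"
      proof (cases "a \<in> A")
        case True
        then have "A - {a} \<in> F1" "A = insert a (A - {a})" using A by (auto simp: F1_def insert_absorb)
        then show ?thesis by blast
      qed (use A in \<open>auto simp: F0_def\<close>)
    qed
  qed (auto simp: F0_def F1_def)
  have cF: "card F = card F0 + card F1"
  proof -
    have "F0 \<inter> insert a ` F1 = {}" by (auto simp: F0_def)
    moreover have "inj_on (insert a) F1"
      by (rule inj_onI) (auto simp: F1_def insert_ident)
    ultimately show ?thesis
      unfolding F using fin by (simp add: card_Un_disjoint card_image)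
  qed
  let ?Sa = "{T. T \<subseteq> U \<and> shatters F0 T}" and ?Sb = "{T. T \<subseteq> U \<and> shatters F1 T}"
  let ?Sc = "{T. T \<subseteq> insert a U \<and> shatters F T}"
  have finS: "finite ?Sa" "finite ?Sb" "finite ?Sc" using insert.hyps(1) by auto
  have un: "?Sa \<union> ?Sb \<union> insert a ` (?Sa \<inter> ?Sb) \<subseteq> ?Sc"
  proof -
    have "F0 \<subseteq> F" by (auto simp: F0_def)
    then have 1: "shatters F T" if "shatters F0 T" for T
      using that unfolding shatters_def by (meson subsetD)
    have 2: "shatters F T" if T: "T \<subseteq> U" "shatters F1 T" for T
      unfolding shatters_def
    proof (intro allI impI)
      fix S assume "S \<subseteq> T"
      then obtain A where "A \<in> F1" "A \<inter> T = S" using T unfolding shatters_def by blast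
      moreover have "insert a A \<inter> T = A \<inter> T" using T insert.hyps by auto
      ultimately have "insert a A \<in> F" "insert a A \<inter> T = S" by (simp_all add: F1_def)
      then show "\<exists>A\<in>F. A \<inter> T = S" by (rule bexI[rotated])
    qed
    have 3: "shatters F (insert a T)" if T: "T \<subseteq> U" "shatters F0 T" "shatters F1 T" for T
      unfolding shatters_def
    proof (intro allI impI)
      fix S assume S: "S \<subseteq> insert a T"
      have aT: "a \<notin> T" using T insert.hyps by auto
      show "\<exists>A\<in>F. A \<inter> insert a T = S"
      proof (cases "a \<in> S")
        case True
        have "S - {a} \<subseteq> T" using S by auto
        then obtain A where A: "A \<in> F1" "A \<inter> T = S - {a}" using T unfolding shatters_def by blast
        then have "insert a A \<inter> insert a T = S" using True by auto
        moreover have "insert a A \<in> F" using A by (simp add: F1_def)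
        ultimately show ?thesis by (rule bexI)
      next
        case False
        then have "S \<subseteq> T" using S by auto
        then obtain A where A: "A \<in> F0" "A \<inter> T = S" using T unfolding shatters_def by blast
        then have "A \<inter> insert a T = S" "A \<in> F" by (simp_all add: F0_def)
        then show ?thesis by (rule bexI)
      qed
    qed
    have "?Sa \<subseteq> ?Sc" "?Sb \<subseteq> ?Sc" using 1 2 by (simp_all add: Collect_mono_iff subset_insertI2)
    moreover have "insert a ` (?Sa \<inter> ?Sb) \<subseteq> ?Sc"
    proof (rule image_subsetI)
      fix T assume "T \<in> ?Sa \<inter> ?Sb"
      then have T: "T \<subseteq> U" "shatters F0 T" "shatters F1 T" by (simp_all only: Int_iff mem_Collect_eq)
      then show "insert a T \<in> ?Sc" using 3[OF T] by auto
    qed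
    ultimately show ?thesis by (simp only: Un_subset_iff)
  qed
  have "card F \<le> card ?Sa + card ?Sb"
    unfolding cF using insert.IH[OF sub(1)] insert.IH[OF sub(2)] by linarith
  also have "\<dots> = card (?Sa \<union> ?Sb) + card (?Sa \<inter> ?Sb)"
    using finS by (intro card_Un_Int) auto
  also have "card (?Sa \<inter> ?Sb) = card (insert a ` (?Sa \<inter> ?Sb))"
    by (rule card_image[symmetric], rule inj_onI) (use insert.hyps in \<open>auto simp: insert_ident\<close>)
  also have "card (?Sa \<union> ?Sb) + card (insert a ` (?Sa \<inter> ?Sb))
             = card (?Sa \<union> ?Sb \<union> insert a ` (?Sa \<inter> ?Sb))"
  proof (rule card_Un_disjoint[symmetric])
    show "(?Sa \<union> ?Sb) \<inter> insert a ` (?Sa \<inter> ?Sb) = {}" using insert.hyps by auto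
  qed (use finS in auto)
  also have "\<dots> \<le> card ?Sc" by (rule card_mono[OF finS(3) un])
  finally show ?case .
qed

text \<open>Complementation pairs the subsets below half size with those above, so the former are at
  most half of \<open>Pow U\<close>. A strict majority shatters more sets than that.\<close>

lemma majority_shatters_half:
  assumes "finite U" "F \<subseteq> Pow U" "2 ^ card U < 2 * card F"
  obtains T where "T \<subseteq> U" "card U \<le> 2 * card T" "shatters F T"
proof -
  let ?L = "{T. T \<subseteq> U \<and> 2 * card T < card U}" and ?H = "{T. T \<subseteq> U \<and> card U < 2 * card T}"
  have fin: "finite ?L" "finite ?H" using assms(1) by auto
  have "card ?L \<le> card ?H"
  proof (rule card_inj_on_le[where f = "\<lambda>T. U - T"])
    show "inj_on (\<lambda>T. U - T) ?L" by (rule inj_onI) blast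
    show "(\<lambda>T. U - T) ` ?L \<subseteq> ?H" using assms(1) by (auto simp: card_Diff_subset finite_subset)
  qed (use fin in auto)
  moreover have "card ?L + card ?H \<le> 2 ^ card U"
  proof -
    have "card ?L + card ?H = card (?L \<union> ?H)" using fin by (intro card_Un_disjoint[symmetric]) auto
    also have "\<dots> \<le> card (Pow U)" using assms(1) by (intro card_mono) auto
    finally show ?thesis using assms(1) by (simp add: card_Pow)
  qed
  ultimately have "card ?L < card F" using assms(3) by linarith
  also have "\<dots> \<le> card {T. T \<subseteq> U \<and> shatters F T}" by (rule card_le_card_shattered[OF assms(1,2)])
  finally have "card ?L < card {T. T \<subseteq> U \<and> shatters F T}" .
  then have "\<not> {T. T \<subseteq> U \<and> shatters F T} \<subseteq> ?L"
    using card_mono[OF fin(1)] by (meson not_less)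
  then obtain T where "T \<subseteq> U" "shatters F T" "\<not> 2 * card T < card U" by blast
  then show ?thesis using that by (simp add: not_less)
qed

text \<open>A sign pattern is encoded as the set of its plus signs. Expectations become sums over
  \<open>Pow I\<close>, without the factor \<open>2 ^ card I\<close>, and shattering applies
  directly to sets of patterns.\<close>

definition sign_of :: "'a set \<Rightarrow> 'a \<Rightarrow> real" where
  "sign_of \<beta> a = (if a \<in> \<beta> then 1 else - 1)"

text \<open>Independence of the signs: the expectation of a product of functions of single signs
  factorises.\<close>

lemma sum_Pow_prod:
  fixes \<phi> :: "'a \<Rightarrow> real \<Rightarrow> real"
  assumes "finite A"
  shows "(\<Sum>\<beta>\<in>Pow A. \<Prod>a\<in>A. \<phi> a (sign_of \<beta> a)) = (\<Prod>a\<in>A. \<phi> a 1 + \<phi> a (-1))"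
  using assms
proof (induction A rule: finite_induct)
  case (insert b A)
  have disj: "Pow A \<inter> insert b ` Pow A = {}" using insert.hyps by auto
  have inj: "inj_on (insert b) (Pow A)"
    by (rule inj_onI) (use insert.hyps in \<open>auto simp: insert_ident\<close>)
  have 1: "(\<Prod>a\<in>insert b A. \<phi> a (sign_of \<beta> a)) = \<phi> b (-1) * (\<Prod>a\<in>A. \<phi> a (sign_of \<beta> a))"
    if "\<beta> \<in> Pow A" for \<beta>
    using that insert.hyps by (auto simp: sign_of_def)
  have 2: "(\<Prod>a\<in>insert b A. \<phi> a (sign_of (insert b \<beta>) a)) = \<phi> b 1 * (\<Prod>a\<in>A. \<phi> a (sign_of \<beta> a))"
    if "\<beta> \<in> Pow A" for \<beta>
  proof -
    have "(\<Prod>a\<in>A. \<phi> a (sign_of (insert b \<beta>) a)) = (\<Prod>a\<in>A. \<phi> a (sign_of \<beta> a))"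
      using insert.hyps by (intro prod.cong) (auto simp: sign_of_def)
    then show ?thesis using insert.hyps by (simp add: sign_of_def)
  qed
  show ?case
    unfolding Pow_insert using insert.hyps insert.IH disj inj
    by (simp add: sum.union_disjoint sum.reindex 1 2 sum_distrib_left[symmetric] algebra_simps
        del: prod.insert) (simp add: algebra_simps)
qed simp

text \<open>Expanding the product, the terms of each degree are dominated by those of the
  exponential series at the sum of absolute values. Both bounds are proved in one induction because
  the second uses the first.\<close>

lemma abs_prod_one_plus_le:
  fixes a :: "'a \<Rightarrow> real"
  assumes "finite A"
  shows "\<bar>(\<Prod>i\<in>A. 1 + a i) - 1\<bar> \<le> exp (\<Sum>i\<in>A. \<bar>a i\<bar>) - 1"
    and "\<bar>(\<Prod>i\<in>A. 1 + a i) - 1 - (\<Sum>i\<in>A. a i)\<bar> \<le> exp (\<Sum>i\<in>A. \<bar>a i\<bar>) - 1 - (\<Sum>i\<in>A. \<bar>a i\<bar>)"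
proof -
  have "\<bar>(\<Prod>i\<in>A. 1 + a i) - 1\<bar> \<le> exp (\<Sum>i\<in>A. \<bar>a i\<bar>) - 1 \<and>
    \<bar>(\<Prod>i\<in>A. 1 + a i) - 1 - (\<Sum>i\<in>A. a i)\<bar> \<le> exp (\<Sum>i\<in>A. \<bar>a i\<bar>) - 1 - (\<Sum>i\<in>A. \<bar>a i\<bar>)"
    using assms
  proof (induction A rule: finite_induct)
    case (insert b A)
    define P where "P = (\<Prod>i\<in>A. 1 + a i)"
    define S where "S = (\<Sum>i\<in>A. \<bar>a i\<bar>)"
    define L where "L = (\<Sum>i\<in>A. a i)"
    have IH: "\<bar>P - 1\<bar> \<le> exp S - 1" "\<bar>P - 1 - L\<bar> \<le> exp S - 1 - S"
      using insert.IH by (auto simp: P_def S_def L_def)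
    have "exp S * (1 + \<bar>a b\<bar>) \<le> exp S * exp \<bar>a b\<bar>"
      by (intro mult_left_mono) auto
    then have e: "exp S * (1 + \<bar>a b\<bar>) \<le> exp (\<bar>a b\<bar> + S)" by (simp add: exp_add mult.commute)
    have m: "\<bar>a b * (P - 1)\<bar> \<le> \<bar>a b\<bar> * (exp S - 1)"
      unfolding abs_mult by (rule mult_left_mono[OF IH(1)]) simp
    have "\<bar>(P - 1) + a b * (P - 1) + a b\<bar> \<le> \<bar>P - 1\<bar> + \<bar>a b * (P - 1)\<bar> + \<bar>a b\<bar>"
      by (intro order.trans[OF abs_triangle_ineq] add_right_mono) simp
    also have "\<dots> \<le> exp S * (1 + \<bar>a b\<bar>) - 1"
      using IH(1) m by (simp add: algebra_simps)
    finally have 1: "\<bar>(1 + a b) * P - 1\<bar> \<le> exp (\<bar>a b\<bar> + S) - 1"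
      using e by (simp add: algebra_simps)
    have "\<bar>(P - 1 - L) + a b * (P - 1)\<bar> \<le> \<bar>P - 1 - L\<bar> + \<bar>a b * (P - 1)\<bar>"
      by simp
    also have "\<dots> \<le> (exp S - 1 - S) + \<bar>a b\<bar> * (exp S - 1)"
      by (rule add_mono[OF IH(2) m])
    also have "\<dots> = exp S * (1 + \<bar>a b\<bar>) - 1 - (\<bar>a b\<bar> + S)" by (simp add: algebra_simps)
    also have "\<dots> \<le> exp (\<bar>a b\<bar> + S) - 1 - (\<bar>a b\<bar> + S)" using e by simp
    also have "(P - 1 - L) + a b * (P - 1) = (1 + a b) * P - 1 - (a b + L)" by (simp add: algebra_simps)
    finally have "\<bar>(1 + a b) * P - 1 - (a b + L)\<bar> \<le> exp (\<bar>a b\<bar> + S) - 1 - (\<bar>a b\<bar> + S)" .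
    with 1
    show ?case using insert.hyps by (simp add: P_def S_def L_def)
  qed simp
  then show "\<bar>(\<Prod>i\<in>A. 1 + a i) - 1\<bar> \<le> exp (\<Sum>i\<in>A. \<bar>a i\<bar>) - 1"
    and "\<bar>(\<Prod>i\<in>A. 1 + a i) - 1 - (\<Sum>i\<in>A. a i)\<bar> \<le> exp (\<Sum>i\<in>A. \<bar>a i\<bar>) - 1 - (\<Sum>i\<in>A. \<bar>a i\<bar>)"
    by auto
qed

lemma exp_second_order_le:
  fixes s :: real
  assumes "0 \<le> s"
  shows "exp s - 1 - s \<le> s\<^sup>2 * exp s"
proof -
  have "(1 - s) * exp s \<le> exp (- s) * exp s"
    using exp_ge_add_one_self[of "- s"] by (intro mult_right_mono) auto
  then have 1: "exp s - 1 \<le> s * exp s" by (simp add: exp_minus algebra_simps)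
  then have "s * (exp s - 1) \<le> s * (s * exp s)" by (rule mult_left_mono[OF _ assms])
  then show ?thesis using 1 by (simp add: power2_eq_square algebra_simps)
qed

lemma markov_count:
  fixes f :: "'a \<Rightarrow> real"
  assumes "finite \<Omega>" "\<And>\<omega>. \<omega> \<in> \<Omega> \<Longrightarrow> 0 \<le> f \<omega>" "sum f \<Omega> \<le> real (card \<Omega>) * E" "0 < E"
  shows "t * real (card {\<omega>\<in>\<Omega>. t * E < f \<omega>}) \<le> real (card \<Omega>)"
proof -
  have "t * E * real (card {\<omega>\<in>\<Omega>. t * E < f \<omega>}) = (\<Sum>\<omega>\<in>{\<omega>\<in>\<Omega>. t * E < f \<omega>}. t * E)" by simp
  also have "\<dots> \<le> sum f {\<omega>\<in>\<Omega>. t * E < f \<omega>}" by (intro sum_mono) auto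
  also have "\<dots> \<le> sum f \<Omega>" using assms by (intro sum_mono2) auto
  also have "\<dots> \<le> real (card \<Omega>) * E" by fact
  finally have "(t * real (card {\<omega>\<in>\<Omega>. t * E < f \<omega>})) * E \<le> real (card \<Omega>) * E"
    by (simp add: mult_ac)
  then show ?thesis using assms(4) by simp
qed

section \<open>Random Riesz products\<close>

definition riesz :: "real \<Rightarrow> 'r set \<Rightarrow> ('r \<Rightarrow> 'x \<Rightarrow> real) \<Rightarrow> 'r set \<Rightarrow> 'x \<Rightarrow> real" where
  "riesz \<delta> I k \<beta> x = (\<Prod>R\<in>I. 1 + \<delta> * sign_of \<beta> R * k R x)"

lemma sign_of_sq [simp]: "sign_of \<beta> R * sign_of \<beta> R = 1"
  by (simp add: sign_of_def)

lemma sum_riesz: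
  assumes "finite I"
  shows "(\<Sum>\<beta>\<in>Pow I. riesz \<delta> I k \<beta> x) = 2 ^ card I"
  using sum_Pow_prod[OF assms, of "\<lambda>R s. 1 + \<delta> * s * k R x"] by (simp add: riesz_def)

lemma sum_sign_riesz:
  assumes "finite I" "R \<in> I"
  shows "(\<Sum>\<beta>\<in>Pow I. sign_of \<beta> R * riesz \<delta> I k \<beta> x) = 2 ^ card I * (\<delta> * k R x)"
proof -
  define \<phi> where "\<phi> = (\<lambda>R' s. (if R' = R then s else 1) * (1 + \<delta> * s * k R' x))"
  have "sign_of \<beta> R * riesz \<delta> I k \<beta> x = (\<Prod>R'\<in>I. \<phi> R' (sign_of \<beta> R'))" for \<beta>
    using assms by (simp add: \<phi>_def riesz_def prod.distrib prod.delta)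
  then have "(\<Sum>\<beta>\<in>Pow I. sign_of \<beta> R * riesz \<delta> I k \<beta> x) = (\<Prod>R'\<in>I. \<phi> R' 1 + \<phi> R' (-1))"
    by (simp add: sum_Pow_prod[OF assms(1)])
  also have "\<dots> = (\<Prod>R'\<in>I. 2 * (if R' = R then \<delta> * k R' x else 1))"
    by (intro prod.cong) (auto simp: \<phi>_def)
  also have "\<dots> = 2 ^ card I * (\<delta> * k R x)"
    using assms by (simp add: prod.distrib prod.delta)
  finally show ?thesis .
qed

lemma sum_riesz_mult:
  assumes "finite I"
  shows "(\<Sum>\<beta>\<in>Pow I. riesz \<delta> I k \<beta> x * riesz \<delta> I k \<beta> y)
         = 2 ^ card I * (\<Prod>R\<in>I. 1 + \<delta>\<^sup>2 * (k R x * k R y))"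
proof -
  define \<phi> where "\<phi> = (\<lambda>R s. (1 + \<delta> * s * k R x) * (1 + \<delta> * s * k R y))"
  have "riesz \<delta> I k \<beta> x * riesz \<delta> I k \<beta> y = (\<Prod>R\<in>I. \<phi> R (sign_of \<beta> R))" for \<beta>
    by (simp add: \<phi>_def riesz_def prod.distrib)
  then have "(\<Sum>\<beta>\<in>Pow I. riesz \<delta> I k \<beta> x * riesz \<delta> I k \<beta> y) = (\<Prod>R\<in>I. \<phi> R 1 + \<phi> R (-1))"
    by (simp add: sum_Pow_prod[OF assms(1)])
  also have "\<dots> = (\<Prod>R\<in>I. 2 * (1 + \<delta>\<^sup>2 * (k R x * k R y)))"
    by (intro prod.cong) (auto simp: \<phi>_def algebra_simps power2_eq_square)
  also have "\<dots> = 2 ^ card I * (\<Prod>R\<in>I. 1 + \<delta>\<^sup>2 * (k R x * k R y))"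
    by (simp only: prod.distrib prod_constant)
  finally show ?thesis .
qed

text \<open>The part of order \<open>\<delta>^4\<close> and higher in the average over \<beta> of
  the product of the values at \<open>x\<close> and \<open>y\<close>.\<close>

definition riesz_rest :: "real \<Rightarrow> 'r set \<Rightarrow> ('r \<Rightarrow> 'x \<Rightarrow> real) \<Rightarrow> 'x \<Rightarrow> 'x \<Rightarrow> real" where
  "riesz_rest \<delta> I k x y = (\<Prod>R\<in>I. 1 + \<delta>\<^sup>2 * (k R x * k R y)) - 1 - (\<Sum>R\<in>I. \<delta>\<^sup>2 * (k R x * k R y))"

text \<open>
  The zeroth order term of the product in \<open>riesz_rest\<close> disappears because \<open>u R\<close> has mean zero, and
  by biorthogonality the first order term is exactly the square of the expected coefficient.
\<close>

lemma riesz_coefficient_variance: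
  fixes u k :: "'r \<Rightarrow> 'x \<Rightarrow> real"
  assumes "finite I" "R \<in> I" "finite X"
    and orth: "\<And>R'. R' \<in> I \<Longrightarrow> (\<Sum>x\<in>X. u R x * k R' x) = (if R' = R then C else 0)"
    and mean: "(\<Sum>x\<in>X. u R x) = 0"
  shows "(\<Sum>\<beta>\<in>Pow I. ((\<Sum>x\<in>X. riesz \<delta> I k \<beta> x * u R x) - \<delta> * C * sign_of \<beta> R)\<^sup>2)
         = 2 ^ card I * (\<Sum>x\<in>X. \<Sum>y\<in>X. u R x * u R y * riesz_rest \<delta> I k x y)"
proof -
  let ?g = "riesz \<delta> I k" and ?N = "2 ^ card I :: real"
  define Y where "Y = (\<lambda>\<beta>. \<Sum>x\<in>X. ?g \<beta> x * u R x)"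
  have Y2: "(\<Sum>\<beta>\<in>Pow I. (Y \<beta>)\<^sup>2) = ?N * (\<Sum>x\<in>X. \<Sum>y\<in>X. u R x * u R y * (\<Prod>R'\<in>I. 1 + \<delta>\<^sup>2 * (k R' x * k R' y)))"
  proof -
    have "(\<Sum>\<beta>\<in>Pow I. (Y \<beta>)\<^sup>2) = (\<Sum>\<beta>\<in>Pow I. \<Sum>x\<in>X. \<Sum>y\<in>X. u R x * u R y * (?g \<beta> x * ?g \<beta> y))"
      by (simp add: Y_def power2_eq_square sum_product mult_ac)
    also have "\<dots> = (\<Sum>x\<in>X. \<Sum>y\<in>X. \<Sum>\<beta>\<in>Pow I. u R x * u R y * (?g \<beta> x * ?g \<beta> y))"
      by (subst sum.swap) (intro sum.cong refl sum.swap)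
    also have "\<dots> = (\<Sum>x\<in>X. \<Sum>y\<in>X. u R x * u R y * (?N * (\<Prod>R'\<in>I. 1 + \<delta>\<^sup>2 * (k R' x * k R' y))))"
      by (simp add: sum_distrib_left[symmetric] sum_riesz_mult[OF assms(1)])
    finally show ?thesis by (simp add: sum_distrib_left mult_ac)
  qed
  have SY: "(\<Sum>\<beta>\<in>Pow I. sign_of \<beta> R * Y \<beta>) = ?N * (\<delta> * C)"
  proof -
    have "(\<Sum>\<beta>\<in>Pow I. sign_of \<beta> R * Y \<beta>) = (\<Sum>\<beta>\<in>Pow I. \<Sum>x\<in>X. u R x * (sign_of \<beta> R * ?g \<beta> x))"
      by (simp add: Y_def sum_distrib_left mult_ac)
    also have "\<dots> = (\<Sum>x\<in>X. u R x * (\<Sum>\<beta>\<in>Pow I. sign_of \<beta> R * ?g \<beta> x))"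
      by (subst sum.swap) (simp add: sum_distrib_left)
    also have "\<dots> = ?N * \<delta> * (\<Sum>x\<in>X. u R x * k R x)"
      by (simp add: sum_sign_riesz[OF assms(1,2)] sum_distrib_left mult_ac)
    finally show ?thesis using orth[OF assms(2)] by simp
  qed
  have lin: "(\<Sum>x\<in>X. \<Sum>y\<in>X. u R x * u R y * (1 + (\<Sum>R'\<in>I. \<delta>\<^sup>2 * (k R' x * k R' y)))) = \<delta>\<^sup>2 * C\<^sup>2"
  proof -
    have "(\<Sum>x\<in>X. \<Sum>y\<in>X. u R x * u R y * (1 + (\<Sum>R'\<in>I. \<delta>\<^sup>2 * (k R' x * k R' y))))
      = (\<Sum>x\<in>X. \<Sum>y\<in>X. u R x * u R y) + (\<Sum>x\<in>X. \<Sum>y\<in>X. \<Sum>R'\<in>I. \<delta>\<^sup>2 * ((u R x * k R' x) * (u R y * k R' y)))"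
      by (simp add: distrib_left sum.distrib sum_distrib_left mult_ac)
    also have "(\<Sum>x\<in>X. \<Sum>y\<in>X. u R x * u R y) = (\<Sum>x\<in>X. u R x) * (\<Sum>x\<in>X. u R x)"
      by (simp add: sum_product)
    also have "(\<Sum>x\<in>X. \<Sum>y\<in>X. \<Sum>R'\<in>I. \<delta>\<^sup>2 * ((u R x * k R' x) * (u R y * k R' y)))
       = (\<Sum>R'\<in>I. \<Sum>x\<in>X. \<Sum>y\<in>X. \<delta>\<^sup>2 * ((u R x * k R' x) * (u R y * k R' y)))"
      by (subst sum.swap[of _ I]) (intro sum.cong refl sum.swap)
    also have "\<dots> = (\<Sum>R'\<in>I. \<delta>\<^sup>2 * ((\<Sum>x\<in>X. u R x * k R' x) * (\<Sum>x\<in>X. u R x * k R' x)))"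
      by (intro sum.cong refl, subst sum_product) (simp only: sum_distrib_left)
    also have "\<dots> = (\<Sum>R'\<in>I. if R' = R then \<delta>\<^sup>2 * C\<^sup>2 else 0)"
      by (intro sum.cong refl) (simp add: orth power2_eq_square)
    finally show ?thesis using assms mean by simp
  qed
  \<comment> \<open>The mean of \<open>sign_of \<beta> R * Y \<beta>\<close> is
    \<open>\<delta> * C\<close>, so expanding the square subtracts the square of this mean from the
    second moment. By \<open>lin\<close> that is exactly the contribution of the terms of degree 0
    and 1.\<close>
  have "(\<Sum>\<beta>\<in>Pow I. (Y \<beta> - \<delta> * C * sign_of \<beta> R)\<^sup>2)
      = (\<Sum>\<beta>\<in>Pow I. (Y \<beta>)\<^sup>2 - 2 * \<delta> * C * (sign_of \<beta> R * Y \<beta>) + \<delta>\<^sup>2 * C\<^sup>2)"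
    by (intro sum.cong refl) (simp add: power2_diff power_mult_distrib power2_eq_square[of "sign_of _ _"])
  also have "\<dots> = (\<Sum>\<beta>\<in>Pow I. (Y \<beta>)\<^sup>2) - 2 * \<delta> * C * (\<Sum>\<beta>\<in>Pow I. sign_of \<beta> R * Y \<beta>) + ?N * (\<delta>\<^sup>2 * C\<^sup>2)"
    using assms(1) by (simp add: sum.distrib sum_subtractf sum_distrib_left card_Pow)
  also have "\<dots> = ?N * ((\<Sum>x\<in>X. \<Sum>y\<in>X. u R x * u R y * (\<Prod>R'\<in>I. 1 + \<delta>\<^sup>2 * (k R' x * k R' y))) - \<delta>\<^sup>2 * C\<^sup>2)"
    unfolding Y2 SY by (simp add: algebra_simps power2_eq_square)
  also have "\<dots> = ?N * (\<Sum>x\<in>X. \<Sum>y\<in>X. u R x * u R y * riesz_rest \<delta> I k x y)"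
    unfolding lin[symmetric] riesz_rest_def by (simp add: sum_subtractf[symmetric] algebra_simps)
  finally show ?thesis unfolding Y_def .
qed

text \<open>
  The Riesz products reproduce the signs \<open>\<beta>\<close> only for most \<open>\<beta>\<close>. By the Sauer--Shelah lemma the good
  \<open>\<beta>\<close> shatter a set \<open>T\<close> containing half of the indices, so that every sign pattern on \<open>T\<close>, however
  exceptional, is the restriction of a good \<open>\<beta>\<close>.
\<close>

lemma biorthogonal_small_ball:
  fixes u k :: "'r \<Rightarrow> 'x \<Rightarrow> real"
  assumes fin: "finite I" "finite X" and ne: "I \<noteq> {}" "X \<noteq> {}"
    and orth: "\<And>R R'. R \<in> I \<Longrightarrow> R' \<in> I \<Longrightarrow> (\<Sum>x\<in>X. u R x * k R' x) = (if R' = R then C else 0)"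
    and mean: "\<And>R. R \<in> I \<Longrightarrow> (\<Sum>x\<in>X. u R x) = 0"
    and k: "\<And>R x. R \<in> I \<Longrightarrow> x \<in> X \<Longrightarrow> \<bar>k R x\<bar> \<le> 1"
    and \<delta>: "0 < \<delta>" "\<delta> \<le> 1" and E: "0 < E"
    and rest: "\<And>R. R \<in> I \<Longrightarrow> (\<Sum>x\<in>X. \<Sum>y\<in>X. \<bar>u R x\<bar> * \<bar>u R y\<bar> * \<bar>riesz_rest \<delta> I k x y\<bar>) \<le> E"
  obtains T where "T \<subseteq> I" "card I \<le> 2 * card T"
    "\<And>\<gamma> S H. S \<subseteq> T \<Longrightarrow> (\<And>R. R \<in> S \<Longrightarrow> \<bar>\<gamma> R\<bar> = 1) \<Longrightarrow>
       (\<And>x. x \<in> X \<Longrightarrow> \<bar>\<Sum>R\<in>S. \<gamma> R * u R x\<bar> \<le> H) \<Longrightarrow>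
       \<delta> * C * real (card S) - sqrt (real (card S)) * sqrt (8 * real (card I) * E) \<le> 8 * real (card X) * H"
proof -
  let ?g = "riesz \<delta> I k"
  define Y where "Y = (\<lambda>\<beta> R. \<Sum>x\<in>X. ?g \<beta> x * u R x)"
  define err where "err = (\<lambda>\<beta>. \<Sum>R\<in>I. (Y \<beta> R - \<delta> * C * sign_of \<beta> R)\<^sup>2)"
  define mass where "mass = (\<lambda>\<beta>. \<Sum>x\<in>X. ?g \<beta> x)"
  define F where "F = {\<beta>\<in>Pow I. mass \<beta> \<le> 8 * real (card X) \<and> err \<beta> \<le> 8 * (real (card I) * E)}"
  have finP: "finite (Pow I)" using fin by simp
  have cP: "real (card (Pow I)) = 2 ^ card I" using fin by (simp add: card_Pow)
  have g_nonneg: "0 \<le> ?g \<beta> x" if "x \<in> X" for \<beta> x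
    unfolding riesz_def
  proof (rule prod_nonneg)
    fix R assume "R \<in> I"
    have "\<bar>\<delta> * sign_of \<beta> R * k R x\<bar> \<le> 1 * 1"
      unfolding abs_mult using \<delta> k[OF \<open>R \<in> I\<close> that]
      by (intro mult_mono) (auto simp: sign_of_def)
    then show "0 \<le> 1 + \<delta> * sign_of \<beta> R * k R x" by linarith
  qed
  \<comment> \<open>Markov's inequality with factor 8 discards at most an eighth of the patterns for
    each of the two requirements in \<open>F\<close>, so that a strict majority remains.\<close>
  have "8 * real (card {\<beta>\<in>Pow I. 8 * real (card X) < mass \<beta>}) \<le> real (card (Pow I))"
  proof (rule markov_count[OF finP])
    show "0 \<le> mass \<beta>" for \<beta> unfolding mass_def by (intro sum_nonneg g_nonneg)
    have "sum mass (Pow I) = (\<Sum>x\<in>X. \<Sum>\<beta>\<in>Pow I. ?g \<beta> x)" unfolding mass_def by (rule sum.swap)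
    then show "sum mass (Pow I) \<le> real (card (Pow I)) * real (card X)"
      by (simp add: sum_riesz[OF fin(1)] cP)
    show "0 < real (card X)" using fin ne by (simp add: card_gt_0_iff)
  qed
  moreover have "8 * real (card {\<beta>\<in>Pow I. 8 * (real (card I) * E) < err \<beta>}) \<le> real (card (Pow I))"
  proof (rule markov_count[OF finP])
    show "0 \<le> err \<beta>" for \<beta> unfolding err_def by (intro sum_nonneg) simp
    have "sum err (Pow I) = (\<Sum>R\<in>I. \<Sum>\<beta>\<in>Pow I. (Y \<beta> R - \<delta> * C * sign_of \<beta> R)\<^sup>2)"
      unfolding err_def by (rule sum.swap)
    also have "\<dots> \<le> (\<Sum>R\<in>I. 2 ^ card I * E)"
    proof (rule sum_mono)
      fix R assume R: "R \<in> I"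
      have "(\<Sum>\<beta>\<in>Pow I. (Y \<beta> R - \<delta> * C * sign_of \<beta> R)\<^sup>2)
          = 2 ^ card I * (\<Sum>x\<in>X. \<Sum>y\<in>X. u R x * u R y * riesz_rest \<delta> I k x y)"
        unfolding Y_def using fin R orth mean by (intro riesz_coefficient_variance) auto
      also have "\<dots> \<le> 2 ^ card I * (\<Sum>x\<in>X. \<Sum>y\<in>X. \<bar>u R x\<bar> * \<bar>u R y\<bar> * \<bar>riesz_rest \<delta> I k x y\<bar>)"
        by (intro mult_left_mono sum_mono) (auto simp: abs_mult[symmetric])
      also have "\<dots> \<le> 2 ^ card I * E" using rest[OF R] by (intro mult_left_mono) auto
      finally show "(\<Sum>\<beta>\<in>Pow I. (Y \<beta> R - \<delta> * C * sign_of \<beta> R)\<^sup>2) \<le> 2 ^ card I * E" .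
    qed
    finally show "sum err (Pow I) \<le> real (card (Pow I)) * (real (card I) * E)" by (simp add: cP mult_ac)
    show "0 < real (card I) * E" using fin ne E by (simp add: card_gt_0_iff)
  qed
  moreover have "card (Pow I) \<le> card F + card {\<beta>\<in>Pow I. 8 * real (card X) < mass \<beta>}
      + card {\<beta>\<in>Pow I. 8 * (real (card I) * E) < err \<beta>}"
  proof -
    have "card (Pow I) \<le> card (F \<union> {\<beta>\<in>Pow I. 8 * real (card X) < mass \<beta>} \<union> {\<beta>\<in>Pow I. 8 * (real (card I) * E) < err \<beta>})"
      using finP by (intro card_mono) (auto simp: F_def)
    then show ?thesis by (meson card_Un_le le_trans add_right_mono)
  qed
  moreover have "0 < card (Pow I)" using fin by (simp add: card_Pow)
  ultimately have "card (Pow I) < 2 * card F" by linarith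
  then have "2 ^ card I < 2 * card F" using fin by (simp add: card_Pow)
  then obtain T where T: "T \<subseteq> I" "card I \<le> 2 * card T" "shatters F T"
    using majority_shatters_half[OF fin(1), of F] by (auto simp: F_def)
  show ?thesis
  proof (rule that[OF T(1,2)])
    fix \<gamma> :: "'r \<Rightarrow> real" and S H
    assume S: "S \<subseteq> T" and \<gamma>: "\<And>R. R \<in> S \<Longrightarrow> \<bar>\<gamma> R\<bar> = 1"
      and H: "\<And>x. x \<in> X \<Longrightarrow> \<bar>\<Sum>R\<in>S. \<gamma> R * u R x\<bar> \<le> H"
    have SI: "S \<subseteq> I" using S T by blast
    have finS: "finite S" using SI fin finite_subset by blast
    \<comment> \<open>On \<open>T\<close> the pattern is prescribed as minus wherever \<gamma> is
      not 1 on \<open>S\<close>. Outside \<open>T\<close> it is uncontrolled, but only indices in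
      \<open>S\<close> enter the pairing.\<close>
    obtain \<beta> where \<beta>: "\<beta> \<in> F" "\<beta> \<inter> T = {R\<in>S. \<gamma> R = 1}"
      using T(3) S unfolding shatters_def by (metis (no_types, lifting) mem_Collect_eq subset_iff)
    have sg: "\<gamma> R = sign_of \<beta> R" if "R \<in> S" for R
      using \<gamma>[OF that] \<beta>(2) S that by (auto simp: sign_of_def)
    have H0: "0 \<le> H" using H ne by force
    have "(\<Sum>R\<in>S. \<gamma> R * Y \<beta> R) = (\<Sum>x\<in>X. ?g \<beta> x * (\<Sum>R\<in>S. \<gamma> R * u R x))"
      unfolding Y_def sum_distrib_left by (subst sum.swap) (simp add: mult_ac)
    also have "\<dots> \<le> (\<Sum>x\<in>X. ?g \<beta> x * H)"
      by (intro sum_mono mult_left_mono g_nonneg) (use H in \<open>auto simp: abs_le_iff\<close>)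
    also have "\<dots> = mass \<beta> * H" by (simp add: mass_def sum_distrib_right)
    also have "\<dots> \<le> 8 * real (card X) * H" using \<beta>(1) H0 by (intro mult_right_mono) (auto simp: F_def)
    finally have up: "(\<Sum>R\<in>S. \<gamma> R * Y \<beta> R) \<le> 8 * real (card X) * H" .
    have eq: "(\<Sum>R\<in>S. \<gamma> R * Y \<beta> R) = \<delta> * C * real (card S) + (\<Sum>R\<in>S. sign_of \<beta> R * (Y \<beta> R - \<delta> * C * sign_of \<beta> R))"
      by (simp add: sg algebra_simps sum.distrib sum_subtractf)
    \<comment> \<open>The errors are controlled only jointly in \<open>l^2\<close>. Cauchy-Schwarz
      costs \<open>sqrt (card S)\<close> against a main term of size \<open>card S\<close>, which is
      affordable when \<open>S\<close> is comparable to \<open>I\<close>.\<close>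
    have "\<bar>\<Sum>R\<in>S. sign_of \<beta> R * (Y \<beta> R - \<delta> * C * sign_of \<beta> R)\<bar>
       \<le> L2_set (\<lambda>R. sign_of \<beta> R) S * L2_set (\<lambda>R. Y \<beta> R - \<delta> * C * sign_of \<beta> R) S"
      by (rule order.trans[OF sum_abs]) (simp add: abs_mult L2_set_mult_ineq)
    also have "L2_set (\<lambda>R. sign_of \<beta> R) S = sqrt (real (card S))"
      by (simp add: L2_set_def power2_eq_square)
    also have "L2_set (\<lambda>R. Y \<beta> R - \<delta> * C * sign_of \<beta> R) S \<le> sqrt (8 * real (card I) * E)"
    proof -
      have "(\<Sum>R\<in>S. (Y \<beta> R - \<delta> * C * sign_of \<beta> R)\<^sup>2) \<le> err \<beta>"
        unfolding err_def using SI fin by (intro sum_mono2) auto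
      also have "\<dots> \<le> 8 * (real (card I) * E)" using \<beta>(1) by (simp add: F_def)
      finally show ?thesis by (simp add: L2_set_def mult_ac)
    qed
    finally have "\<bar>\<Sum>R\<in>S. sign_of \<beta> R * (Y \<beta> R - \<delta> * C * sign_of \<beta> R)\<bar>
       \<le> sqrt (real (card S)) * sqrt (8 * real (card I) * E)"
      by (simp add: mult_left_mono)
    then show "\<delta> * C * real (card S) - sqrt (real (card S)) * sqrt (8 * real (card I) * E) \<le> 8 * real (card X) * H"
      using up eq by linarith
  qed
qed

section \<open>A biorthogonal pair in one dimension\<close>

text \<open>
  \<open>zigzag\<close> is the fourth difference of the ramp function, a continuous function which is linear on
  quarters of \<open>[0,1]\<close>, has mean zero, and vanishes outside. The sign pattern \<open>+ - - +\<close> on quarters is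
  orthogonal to affine functions. Hence a rescaled \<open>zigzag\<close> sees the pattern on its own interval and
  no pattern on any other \<open>4\<close>-adic interval, of whatever length. In \<open>zigzag_at N r j\<close> and
  \<open>qsign N r j\<close> the interval is \<open>[j/4\<^sup>r,(j+1)/4\<^sup>r]\<close> and the argument \<open>x\<close> stands for the midpoint of the
  \<open>x\<close>-th interval of length \<open>1/4\<^sup>N\<close>; sums over midpoints of a function linear on these intervals are
  integrals.
\<close>

definition zigzag :: "real \<Rightarrow> real" where
  "zigzag t = max 0 t - 4 * max 0 (t - 1/4) + 6 * max 0 (t - 1/2) - 4 * max 0 (t - 3/4) + max 0 (t - 1)"

definition quarter_sign :: "nat \<Rightarrow> real" where
  "quarter_sign a = (if a = 0 \<or> a = 3 then 1 else - 1)"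

definition qsign :: "nat \<Rightarrow> nat \<Rightarrow> nat \<Rightarrow> nat \<Rightarrow> real" where
  "qsign N s l x = (if x div 4 ^ (N - s) = l then quarter_sign (x div 4 ^ (N - s - 1) mod 4) else 0)"

definition zigzag_at :: "nat \<Rightarrow> nat \<Rightarrow> nat \<Rightarrow> nat \<Rightarrow> real" where
  "zigzag_at N r j x = zigzag ((real x + 1/2) / 4 ^ (N - r) - real j)"

lemma zigzag_outside: "t \<le> 0 \<or> 1 \<le> t \<Longrightarrow> zigzag t = 0"
  by (auto simp: zigzag_def max_def)

lemma zigzag_quarters:
  "0 \<le> t \<Longrightarrow> t \<le> 1/4 \<Longrightarrow> zigzag t = t"
  "1/4 \<le> t \<Longrightarrow> t \<le> 1/2 \<Longrightarrow> zigzag t = 1 - 3 * t"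
  "1/2 \<le> t \<Longrightarrow> t \<le> 3/4 \<Longrightarrow> zigzag t = 3 * t - 2"
  "3/4 \<le> t \<Longrightarrow> t \<le> 1 \<Longrightarrow> zigzag t = 1 - t"
  by (auto simp: zigzag_def max_def)

lemma abs_zigzag_le: "\<bar>zigzag t\<bar> \<le> 1"
  by (auto simp: zigzag_def max_def abs_le_iff)

lemma zigzag_affine_on_quarter:
  fixes i :: int
  obtains A B where "\<And>t. of_int i / 4 \<le> t \<Longrightarrow> t \<le> (of_int i + 1) / 4 \<Longrightarrow> zigzag t = A + B * t"
proof -
  consider "i < 0" | "i = 0" | "i = 1" | "i = 2" | "i = 3" | "4 \<le> i" by linarith
  then show ?thesis
  proof cases
    case 1
    then have "of_int i \<le> (-1 :: real)" by linarith
    then show ?thesis using that[of 0 0] by (auto simp: zigzag_outside)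
  next
    case 6
    then have "4 \<le> (of_int i :: real)" by linarith
    then show ?thesis using that[of 0 0] by (auto simp: zigzag_outside)
  qed (use that[of 0 1] that[of 1 "-3"] that[of "-2" 3] that[of 1 "-1"] in \<open>auto simp: zigzag_quarters\<close>)
qed

lemma zigzag_at_outside: "x div 4 ^ (N - r) \<noteq> j \<Longrightarrow> zigzag_at N r j x = 0"
proof -
  define K :: nat where "K = 4 ^ (N - r)"
  have K: "0 < K" by (simp add: K_def)
  assume "x div 4 ^ (N - r) \<noteq> j"
  then have "x div K < j \<or> j < x div K" by (auto simp: K_def)
  then have "x + 1 \<le> j * K \<or> (j + 1) * K \<le> x"
    using K by (metis Suc_eq_plus1 Suc_leI div_le_mono div_less_iff_less_mult less_eq_div_iff_mult_less_eq)
  then have "real x + 1 \<le> real j * real K \<or> (real j + 1) * real K \<le> real x"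
    by (metis of_nat_1 of_nat_add of_nat_le_iff of_nat_mult)
  then have "(real x + 1/2) / real K - real j \<le> 0 \<or> 1 \<le> (real x + 1/2) / real K - real j"
    using K by (auto simp: field_simps)
  then show ?thesis unfolding zigzag_at_def using zigzag_outside by (auto simp: K_def)
qed

lemma abs_zigzag_at_le: "\<bar>zigzag_at N r j x\<bar> \<le> (if x div 4 ^ (N - r) = j then 1 else 0)"
  using zigzag_at_outside[of x N r j] abs_zigzag_le by (auto simp: zigzag_at_def)

section \<open>Sums over 4-adic intervals and one-dimensional biorthogonality\<close>

lemma sum_block:
  fixes f :: "nat \<Rightarrow> real"
  assumes "L \<le> N" "l < 4 ^ (N - L)"
  shows "(\<Sum>x<4 ^ N. if x div 4 ^ L = l then f x else 0) = (\<Sum>t<4 ^ L. f (l * 4 ^ L + t))"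
proof -
  define K :: nat where "K = 4 ^ L"
  have K: "0 < K" by (simp add: K_def)
  have "4 ^ N = 4 ^ (N - L) * K" using assms(1) by (simp add: K_def power_add[symmetric])
  moreover have "(l + 1) * K \<le> 4 ^ (N - L) * K" using assms(2) by (intro mult_right_mono) auto
  ultimately have lK: "(l + 1) * K \<le> 4 ^ N" by simp
  have "{x\<in>{..<4 ^ N}. x div K = l} = (\<lambda>t. l * K + t) ` {..<K}"
  proof (intro equalityI subsetI)
    fix x assume "x \<in> {x\<in>{..<4 ^ N}. x div K = l}"
    then have "x = l * K + x mod K" "x mod K < K" using K div_mult_mod_eq[of x K] by auto
    then show "x \<in> (\<lambda>t. l * K + t) ` {..<K}" by blast
  next
    fix x assume "x \<in> (\<lambda>t. l * K + t) ` {..<K}"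
    then obtain t where "t < K" "x = l * K + t" by auto
    then show "x \<in> {x\<in>{..<4 ^ N}. x div K = l}" using lK K by (auto simp: algebra_simps)
  qed
  moreover have "(\<Sum>x<4 ^ N. if x div K = l then f x else 0) = sum f {x\<in>{..<4 ^ N}. x div K = l}"
    by (subst sum.inter_filter) auto
  ultimately show ?thesis unfolding K_def[symmetric] by (simp add: sum.reindex inj_on_def)
qed

lemma sum_quarters:
  fixes f :: "nat \<Rightarrow> real"
  assumes "0 < L"
  shows "(\<Sum>t<4 ^ L. f t) = (\<Sum>a<4. \<Sum>b<4 ^ (L - 1). f (a * 4 ^ (L - 1) + b))"
proof -
  define K :: nat where "K = 4 ^ (L - 1)"
  have "4 ^ L = 4 * K" using assms by (cases L) (auto simp: K_def)
  then have "(\<Sum>t<4 ^ L. f t) = (\<Sum>a<4. sum f {a * K..<a * K + K})"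
    by (simp add: sum.nat_group)
  also have "\<dots> = (\<Sum>a<4. \<Sum>b<K. f (a * K + b))"
  proof (rule sum.cong[OF refl])
    fix a
    show "sum f {a * K..<a * K + K} = (\<Sum>b<K. f (a * K + b))"
      using sum.shift_bounds_nat_ivl[of f 0 "a * K" K] by (simp add: atLeast0LessThan add.commute)
  qed
  finally show ?thesis unfolding K_def .
qed

lemma sum_midpoints: "(\<Sum>b<K. real b + 1/2) = (real K)\<^sup>2 / 2"
proof (induction K)
  case (Suc K)
  then show ?case by (simp add: power2_eq_square) (simp add: algebra_simps)
qed simp

text \<open>The average of an affine function over the midpoints is its value at the centre, and
  \<open>zigzag\<close> takes the values 1/8, -1/8, -1/8, 1/8 at the centres of the quarters, with
  the signs of \<open>quarter_sign\<close>.\<close>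

lemma sum_zigzag_quarter:
  assumes "a < 4" "0 < K"
  shows "(\<Sum>b<K. zigzag ((real (a * K + b) + 1/2) / (4 * real K))) = quarter_sign a * real K / 8"
proof -
  have sm: "(\<Sum>b<K. A + B * ((real (a * K + b) + 1/2) / (4 * real K))) = real K * (A + B * (real a / 4 + 1/8))" for A B
  proof -
    have "(\<Sum>b<K. A + B * ((real (a * K + b) + 1/2) / (4 * real K)))
        = (\<Sum>b<K. A + B * real a / 4 + B / (4 * real K) * (real b + 1/2))"
      by (intro sum.cong refl) (use assms(2) in \<open>simp add: field_simps\<close>)
    also have "\<dots> = real K * (A + B * real a / 4) + B / (4 * real K) * ((real K)\<^sup>2 / 2)"
      by (subst sum.distrib) (simp only: sum_distrib_left[symmetric] sum_midpoints sum_constant card_lessThan)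
    finally show ?thesis using assms(2) by (simp add: field_simps power2_eq_square)
  qed
  have bd: "real a / 4 \<le> (real (a * K + b) + 1/2) / (4 * real K)"
           "(real (a * K + b) + 1/2) / (4 * real K) \<le> (real a + 1) / 4" if "b < K" for b
  proof -
    have "real b + 1 \<le> real K" using that by linarith
    then show "real a / 4 \<le> (real (a * K + b) + 1/2) / (4 * real K)"
           "(real (a * K + b) + 1/2) / (4 * real K) \<le> (real a + 1) / 4"
      using assms(2) by (auto simp: field_simps)
  qed
  obtain A B where AB: "\<And>t. real a / 4 \<le> t \<Longrightarrow> t \<le> (real a + 1) / 4 \<Longrightarrow> zigzag t = A + B * t"
      "A + B * (real a / 4 + 1/8) = quarter_sign a / 8"
  proof -
    consider "a = 0" | "a = 1" | "a = 2" | "a = 3" using assms(1) by linarith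
    then show thesis
    proof cases
      case 1 show ?thesis by (rule that[of 0 1]) (use 1 zigzag_quarters in \<open>auto simp: quarter_sign_def\<close>)
    next
      case 2 show ?thesis by (rule that[of 1 "-3"]) (use 2 zigzag_quarters in \<open>auto simp: quarter_sign_def\<close>)
    next
      case 3 show ?thesis by (rule that[of "-2" 3]) (use 3 zigzag_quarters in \<open>auto simp: quarter_sign_def\<close>)
    next
      case 4 show ?thesis by (rule that[of 1 "-1"]) (use 4 zigzag_quarters in \<open>auto simp: quarter_sign_def\<close>)
    qed
  qed
  have "(\<Sum>b<K. zigzag ((real (a * K + b) + 1/2) / (4 * real K)))
     = (\<Sum>b<K. A + B * ((real (a * K + b) + 1/2) / (4 * real K)))"
    by (intro sum.cong refl AB(1) bd) auto
  also have "\<dots> = real K * (quarter_sign a / 8)" unfolding sm AB(2) ..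
  finally show ?thesis by (simp add: mult.commute)
qed

lemma sum_over_zigzag_at:
  fixes f :: "nat \<Rightarrow> real"
  assumes "r < N" "j < 4 ^ r"
  shows "(\<Sum>x<4 ^ N. zigzag_at N r j x * f x)
       = (\<Sum>a<4. \<Sum>b<4 ^ (N - r - 1). zigzag ((real (a * 4 ^ (N - r - 1) + b) + 1/2) / 4 ^ (N - r))
            * f (j * 4 ^ (N - r) + (a * 4 ^ (N - r - 1) + b)))"
proof -
  have "(\<Sum>x<4 ^ N. zigzag_at N r j x * f x)
      = (\<Sum>x<4 ^ N. if x div 4 ^ (N - r) = j then zigzag_at N r j x * f x else 0)"
    by (intro sum.cong refl) (auto simp: zigzag_at_outside)
  also have "\<dots> = (\<Sum>t<4 ^ (N - r). zigzag_at N r j (j * 4 ^ (N - r) + t) * f (j * 4 ^ (N - r) + t))"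
    using assms by (intro sum_block) auto
  also have "\<dots> = (\<Sum>t<4 ^ (N - r). zigzag ((real t + 1/2) / 4 ^ (N - r)) * f (j * 4 ^ (N - r) + t))"
    by (simp add: zigzag_at_def add_divide_distrib)
  also have "\<dots> = (\<Sum>a<4. \<Sum>b<4 ^ (N - r - 1). zigzag ((real (a * 4 ^ (N - r - 1) + b) + 1/2) / 4 ^ (N - r))
            * f (j * 4 ^ (N - r) + (a * 4 ^ (N - r - 1) + b)))"
    using assms by (intro sum_quarters) auto
  finally show ?thesis .
qed

lemma sum_zigzag_at:
  assumes "r < N" "j < 4 ^ r"
  shows "(\<Sum>x<4 ^ N. zigzag_at N r j x) = 0"
proof -
  define K :: nat where "K = 4 ^ (N - r - 1)"
  have NK: "(4 :: real) ^ (N - r) = 4 * real K"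
    using assms by (cases "N - r") (auto simp: K_def)
  have K: "0 < K" by (simp add: K_def)
  have "(\<Sum>x<4 ^ N. zigzag_at N r j x) = (\<Sum>a<4. \<Sum>b<K. zigzag ((real (a * K + b) + 1/2) / (4 * real K)))"
    using sum_over_zigzag_at[OF assms, of "\<lambda>_. 1"] unfolding NK K_def[symmetric] mult_1_right .
  also have "\<dots> = (\<Sum>a<4. quarter_sign a * real K / 8)"
    using sum_zigzag_quarter[OF _ K] by (intro sum.cong refl) (simp only: lessThan_iff)
  finally have "(\<Sum>x<4 ^ N. zigzag_at N r j x) = (\<Sum>a<4. quarter_sign a * real K / 8)" .
  then show ?thesis by (simp add: quarter_sign_def eval_nat_numeral lessThan_Suc)
qed

lemma quaternary_digit:
  fixes K :: nat
  assumes "a < 4" "b < K"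
  shows "a * K + b < 4 * K" "(l * (4 * K) + (a * K + b)) div (4 * K) = l"
    "(l * (4 * K) + (a * K + b)) div K mod 4 = a"
proof -
  have "a * K + b < (a + 1) * K" using assms by simp
  also have "\<dots> \<le> 4 * K" using assms by (intro mult_right_mono) auto
  finally show lt: "a * K + b < 4 * K" .
  have "(a * K + b + l * (4 * K)) div (4 * K) = l + (a * K + b) div (4 * K)"
    using assms by (intro div_mult_self1) auto
  then show "(l * (4 * K) + (a * K + b)) div (4 * K) = l" using lt by (simp only: add.commute div_less)
  have "(b + (4 * l + a) * K) div K = (4 * l + a) + b div K"
    using assms by (intro div_mult_self1) auto
  moreover have "l * (4 * K) + (a * K + b) = b + (4 * l + a) * K" by (simp add: algebra_simps)
  ultimately have "(l * (4 * K) + (a * K + b)) div K = 4 * l + a"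
    using assms by (simp only: div_less add_0_right)
  then show "(l * (4 * K) + (a * K + b)) div K mod 4 = a" using assms by simp
qed

lemma sum_zigzag_at_qsign_same:
  assumes "r < N" "j < 4 ^ r"
  shows "(\<Sum>x<4 ^ N. zigzag_at N r j x * qsign N r j x) = 4 ^ (N - r) / 8"
proof -
  define K :: nat where "K = 4 ^ (N - r - 1)"
  have K: "0 < K" by (simp add: K_def)
  have NK: "(4 :: real) ^ (N - r) = 4 * real K" "(4 :: nat) ^ (N - r) = 4 * K"
    using assms by (cases "N - r"; auto simp: K_def)+
  have k: "qsign N r j (j * (4 * K) + (a * K + b)) = quarter_sign a" if "a < 4" "b < K" for a b
    unfolding qsign_def NK(2) K_def[symmetric] quaternary_digit[OF that] by simp
  have "(\<Sum>x<4 ^ N. zigzag_at N r j x * qsign N r j x)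
     = (\<Sum>a<4. \<Sum>b<K. zigzag ((real (a * K + b) + 1/2) / (4 * real K)) * quarter_sign a)"
    unfolding sum_over_zigzag_at[OF assms] NK K_def[symmetric]
    by (intro sum.cong refl) (simp only: k lessThan_iff)
  also have "\<dots> = (\<Sum>a<4. quarter_sign a * real K / 8 * quarter_sign a)"
    using sum_zigzag_quarter[OF _ K] by (intro sum.cong refl) (simp only: sum_distrib_right[symmetric] lessThan_iff)
  also have "\<dots> = 4 ^ (N - r) / 8"
    unfolding NK by (simp add: quarter_sign_def eval_nat_numeral lessThan_Suc)
  finally show ?thesis .
qed

text \<open>Here the support of \<open>zigzag_at\<close> is the shorter interval.
  \<open>qsign\<close> is constant on it, and \<open>zigzag\<close> has mean zero.\<close>

lemma sum_zigzag_at_qsign_finer: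
  assumes "s < r" "r < N" "j < 4 ^ r"
  shows "(\<Sum>x<4 ^ N. zigzag_at N r j x * qsign N s l x) = 0"
proof -
  have k: "qsign N s l x = qsign N s l (j * 4 ^ (N - r))" if "x div 4 ^ (N - r) = j" for x
  proof -
    have "x div 4 ^ m = (j * 4 ^ (N - r)) div 4 ^ m" if "N - r \<le> m" for m
    proof -
      have "(4 :: nat) ^ m = 4 ^ (N - r) * 4 ^ (m - (N - r))" using that by (simp add: power_add[symmetric])
      then show ?thesis using \<open>x div 4 ^ (N - r) = j\<close> by (simp add: div_mult2_eq)
    qed
    then show ?thesis using assms by (simp add: qsign_def)
  qed
  have "(\<Sum>x<4 ^ N. zigzag_at N r j x * qsign N s l x) = (\<Sum>x<4 ^ N. zigzag_at N r j x * qsign N s l (j * 4 ^ (N - r)))"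
  proof (intro sum.cong refl)
    fix x
    show "zigzag_at N r j x * qsign N s l x = zigzag_at N r j x * qsign N s l (j * 4 ^ (N - r))"
      using k[of x] zigzag_at_outside[of x N r j] by (cases "x div 4 ^ (N - r) = j") auto
  qed
  also have "\<dots> = 0" using sum_zigzag_at[OF assms(2,3)] by (simp add: sum_distrib_right[symmetric])
  finally show ?thesis .
qed

text \<open>The signs 1, -1, -1, 1 at the positions 0, 1, 2, 3 have vanishing sum and vanishing
  first moment.\<close>

lemma sum_qsign_affine:
  assumes "s < N" "l < 4 ^ s"
    and f: "\<And>t. t < 4 ^ (N - s) \<Longrightarrow> f (l * 4 ^ (N - s) + t) = A + B * real t"
  shows "(\<Sum>x<4 ^ N. f x * qsign N s l x) = 0"
proof -
  define K :: nat where "K = 4 ^ (N - s - 1)"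
  have K: "0 < K" by (simp add: K_def)
  have NK: "(4 :: nat) ^ (N - s) = 4 * K" using assms by (cases "N - s") (auto simp: K_def)
  note lt = quaternary_digit(1)
  have k: "qsign N s l (l * (4 * K) + (a * K + b)) = quarter_sign a" if "a < 4" "b < K" for a b
    unfolding qsign_def NK K_def[symmetric] quaternary_digit[OF that] by simp
  have "(\<Sum>x<4 ^ N. f x * qsign N s l x) = (\<Sum>x<4 ^ N. if x div 4 ^ (N - s) = l then f x * qsign N s l x else 0)"
    by (intro sum.cong refl) (auto simp: qsign_def)
  also have "\<dots> = (\<Sum>t<4 ^ (N - s). f (l * 4 ^ (N - s) + t) * qsign N s l (l * 4 ^ (N - s) + t))"
    using assms by (intro sum_block) auto
  also have "\<dots> = (\<Sum>a<4. \<Sum>b<4 ^ (N - s - 1). f (l * 4 ^ (N - s) + (a * 4 ^ (N - s - 1) + b)) * qsign N s l (l * 4 ^ (N - s) + (a * 4 ^ (N - s - 1) + b)))"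
    using assms by (intro sum_quarters) auto
  also have "\<dots> = (\<Sum>a<4. \<Sum>b<K. (A + B * real (a * K + b)) * quarter_sign a)"
    unfolding K_def[symmetric] NK
    using f lt NK by (intro sum.cong refl) (simp only: k lessThan_iff)
  also have "\<dots> = (\<Sum>a<4. (real K * (A + B * real a * real K) + B * (\<Sum>b<K. real b)) * quarter_sign a)"
    by (intro sum.cong refl) (simp add: sum_distrib_right[symmetric] sum.distrib sum_distrib_left distrib_left algebra_simps)
  also have "\<dots> = 0" by (simp add: quarter_sign_def eval_nat_numeral lessThan_Suc algebra_simps)
  finally show ?thesis .
qed

lemma sum_zigzag_at_qsign_coarser:
  assumes "r < s" "s < N" "l < 4 ^ s"
  shows "(\<Sum>x<4 ^ N. zigzag_at N r j x * qsign N s l x) = 0"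
proof -
  define L D where "L = N - s" and "D = N - r - 1"
  have LD: "L \<le> D" "N - r = Suc D" using assms by (auto simp: L_def D_def)
  \<comment> \<open>The interval of \<open>qsign\<close> lies in the \<open>c\<close>-th interval of
    length \<open>1/4 ^ (r + 1)\<close>, on which \<open>zigzag_at\<close> is affine. Relative to
    the support of \<open>zigzag_at\<close> this is quarter \<open>c - 4 * j\<close>, possibly
    outside 0 to 3, whence integers.\<close>
  define c :: nat where "c = l div 4 ^ (D - L)"
  obtain A B where AB: "\<And>t. of_int (int c - 4 * int j) / 4 \<le> t \<Longrightarrow> t \<le> (of_int (int c - 4 * int j) + 1) / 4 \<Longrightarrow> zigzag t = A + B * t"
    using zigzag_affine_on_quarter[of "int c - 4 * int j"] by metis
  have "zigzag_at N r j (l * 4 ^ L + t) = (A + B * ((real l * 4 ^ L + 1/2) / (4 * 4 ^ D) - real j)) + (B * (1 / (4 * 4 ^ D))) * real t"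
    if "t < 4 ^ L" for t
  proof -
    define x where "x = l * 4 ^ L + t"
    define P :: nat where "P = 4 ^ D"
    have P: "0 < P" by (simp add: P_def)
    have "P = 4 ^ L * 4 ^ (D - L)" using LD(1) by (simp add: P_def power_add[symmetric])
    then have "x div P = c" using that by (simp add: x_def c_def div_mult2_eq)
    then have "c * P \<le> x" "x < (c + 1) * P"
      using div_mult_mod_eq[of x P] mod_less_divisor[OF P, of x] by (simp_all add: algebra_simps)
    then have "real c * real P \<le> real x" "real x + 1 \<le> (real c + 1) * real P"
      by (metis of_nat_le_iff of_nat_mult) (use \<open>x < (c + 1) * P\<close> in \<open>metis Suc_eq_plus1 Suc_leI of_nat_Suc of_nat_le_iff of_nat_mult add.commute\<close>)
    then have cz: "real c \<le> (real x + 1/2) / real P" "(real x + 1/2) / real P \<le> real c + 1"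
      using P by (auto simp: field_simps)
    define z v w :: real where "z = (real x + 1/2) / (4 * 4 ^ D)"
      and "v = (real l * 4 ^ L + 1/2) / (4 * 4 ^ D)" and "w = 1 / (4 * 4 ^ D)"
    have zP: "4 * z = (real x + 1/2) / real P"
      by (simp add: z_def P_def field_simps)
    have "zigzag (z - real j) = A + B * (z - real j)"
      by (intro AB; use cz zP in simp)
    moreover have "z = v + w * real t"
      by (simp add: z_def v_def w_def x_def field_simps)
    moreover have "A + B * (v + w * real t - real j) = (A + B * (v - real j)) + (B * w) * real t"
      by (simp add: algebra_simps)
    ultimately have "zigzag (z - real j) = (A + B * (v - real j)) + (B * w) * real t" by (simp only:)
    then show "zigzag_at N r j (l * 4 ^ L + t) = (A + B * ((real l * 4 ^ L + 1/2) / (4 * 4 ^ D) - real j)) + (B * (1 / (4 * 4 ^ D))) * real t"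
      unfolding zigzag_at_def LD(2) x_def[symmetric] power_Suc z_def[symmetric] v_def[symmetric] w_def[symmetric] .
  qed
  note affine = this
  show ?thesis
    by (rule sum_qsign_affine[OF assms(2,3), where f = "zigzag_at N r j", OF affine[unfolded L_def]])
qed

lemma zigzag_at_qsign_biorthogonal:
  assumes "r < N" "j < 4 ^ r" "s < N" "l < 4 ^ s"
  shows "(\<Sum>x<4 ^ N. zigzag_at N r j x * qsign N s l x) = (if (r, j) = (s, l) then 4 ^ (N - r) / 8 else 0)"
proof -
  consider "r < s" | "s < r" | "r = s" "j = l" | "r = s" "j \<noteq> l" by linarith
  then show ?thesis
  proof cases
    case 4
    then have "zigzag_at N r j x * qsign N s l x = 0" for x
      using zigzag_at_outside[of x N r j] by (auto simp: qsign_def)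
    then have "(\<Sum>x<4 ^ N. zigzag_at N r j x * qsign N s l x) = 0" by (simp only: sum.neutral_const)
    then show ?thesis using 4 by simp
  qed (use assms sum_zigzag_at_qsign_coarser sum_zigzag_at_qsign_finer sum_zigzag_at_qsign_same in auto)
qed

section \<open>Boxes of equal volume\<close>

type_synonym 'n box = "('n \<Rightarrow> nat) \<times> ('n \<Rightarrow> nat)"

text \<open>
  A box is given by the levels and the positions of its \<open>4\<close>-adic sides. The boxes in \<open>boxes q i0\<close> all
  have volume \<open>4\<close> to the power \<open>- CARD('n) * q\<close>; all levels except the one of the coordinate \<open>i0\<close> vary
  freely below \<open>q\<close>.
\<close>

definition shapes :: "nat \<Rightarrow> 'n::finite \<Rightarrow> ('n \<Rightarrow> nat) set" where
  "shapes q i0 = {r. (\<forall>i. i \<noteq> i0 \<longrightarrow> r i < q) \<and> (\<Sum>i\<in>UNIV. r i) = CARD('n) * q}"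

definition boxes :: "nat \<Rightarrow> 'n::finite \<Rightarrow> 'n box set" where
  "boxes q i0 = Sigma (shapes q i0) (\<lambda>r. PiE UNIV (\<lambda>i. {..<4 ^ r i}))"

definition grid :: "nat \<Rightarrow> ('n::finite \<Rightarrow> nat) set" where
  "grid N = PiE UNIV (\<lambda>_. {..<4 ^ N})"

definition box_zigzag :: "nat \<Rightarrow> 'n::finite box \<Rightarrow> ('n \<Rightarrow> nat) \<Rightarrow> real" where
  "box_zigzag N R x = (\<Prod>i\<in>UNIV. zigzag_at N (fst R i) (snd R i) (x i))"

definition box_qsign :: "nat \<Rightarrow> 'n::finite box \<Rightarrow> ('n \<Rightarrow> nat) \<Rightarrow> real" where
  "box_qsign N R x = (\<Prod>i\<in>UNIV. qsign N (fst R i) (snd R i) (x i))"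

lemma shapes_le: "r \<in> shapes q (i0 :: 'n::finite) \<Longrightarrow> r i \<le> CARD('n) * q"
  unfolding shapes_def using member_le_sum[of i UNIV r] by auto

text \<open>The fixed total determines the level of \<open>i0\<close> from the others. These sum to
  at most \<open>CARD('n) * q\<close>, so the subtraction is not truncated.\<close>

lemma bij_betw_shapes:
  fixes i0 :: "'n::finite"
  shows "bij_betw (\<lambda>r. restrict r (UNIV - {i0})) (shapes q i0) (PiE (UNIV - {i0}) (\<lambda>_. {..<q}))"
proof (rule bij_betw_byWitness[where f' = "\<lambda>g. g(i0 := CARD('n) * q - (\<Sum>i\<in>UNIV - {i0}. g i))"])
  have sum_split: "(\<Sum>i\<in>UNIV. r i) = r i0 + (\<Sum>i\<in>UNIV - {i0}. r i)" for r :: "'n \<Rightarrow> nat"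
    by (simp add: sum.remove[of UNIV i0])
  show "\<forall>r\<in>shapes q i0. (restrict r (UNIV - {i0}))(i0 := CARD('n) * q - (\<Sum>i\<in>UNIV - {i0}. restrict r (UNIV - {i0}) i)) = r"
  proof (intro ballI ext)
    fix r i assume "r \<in> shapes q i0"
    then have "r i0 + (\<Sum>i\<in>UNIV - {i0}. r i) = CARD('n) * q" unfolding shapes_def sum_split by blast
    then have "r i0 = CARD('n) * q - (\<Sum>i\<in>UNIV - {i0}. r i)" by linarith
    then show "((restrict r (UNIV - {i0}))(i0 := CARD('n) * q - (\<Sum>i\<in>UNIV - {i0}. restrict r (UNIV - {i0}) i))) i = r i"
      by simp
  qed
  show "\<forall>g\<in>PiE (UNIV - {i0}) (\<lambda>_. {..<q}). restrict (g(i0 := CARD('n) * q - (\<Sum>i\<in>UNIV - {i0}. g i))) (UNIV - {i0}) = g"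
    by (auto simp: fun_eq_iff PiE_def extensional_def)
  show "(\<lambda>r. restrict r (UNIV - {i0})) ` shapes q i0 \<subseteq> PiE (UNIV - {i0}) (\<lambda>_. {..<q})"
  proof (intro image_subsetI PiE_I)
    fix r i assume "r \<in> shapes q i0" "i \<in> UNIV - {i0}"
    then show "restrict r (UNIV - {i0}) i \<in> {..<q}" by (simp add: shapes_def)
  qed simp
  show "(\<lambda>g. g(i0 := CARD('n) * q - (\<Sum>i\<in>UNIV - {i0}. g i))) ` PiE (UNIV - {i0}) (\<lambda>_. {..<q}) \<subseteq> shapes q i0"
  proof (rule image_subsetI)
    fix g assume g: "g \<in> PiE (UNIV - {i0}) (\<lambda>_. {..<q})"
    then have lt: "g i < q" if "i \<noteq> i0" for i using that by auto
    have "(\<Sum>i\<in>UNIV - {i0}. g i) \<le> (\<Sum>i\<in>UNIV - {i0}. q)" using lt by (intro sum_mono) (auto intro: less_imp_le)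
    also have "\<dots> \<le> CARD('n) * q" by (simp add: card_Diff_singleton)
    finally show "g(i0 := CARD('n) * q - (\<Sum>i\<in>UNIV - {i0}. g i)) \<in> shapes q i0"
      using lt by (auto simp: shapes_def sum_split)
  qed
qed

lemma finite_shapes: "finite (shapes q i0)"
  using bij_betw_finite[OF bij_betw_shapes[of i0 q]] by (simp add: finite_PiE)

lemma card_shapes: "card (shapes q (i0 :: 'n::finite)) = q ^ (CARD('n) - 1)"
  using bij_betw_same_card[OF bij_betw_shapes[of i0 q]] by (simp add: card_PiE card_Diff_singleton)

lemma finite_boxes: "finite (boxes q i0)"
  unfolding boxes_def by (intro finite_SigmaI finite_shapes finite_PiE) auto

lemma card_boxes: "card (boxes q (i0 :: 'n::finite)) = q ^ (CARD('n) - 1) * 4 ^ (CARD('n) * q)"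
proof -
  have "card (boxes q i0) = (\<Sum>r\<in>shapes q i0. card (PiE (UNIV :: 'n set) (\<lambda>i. {..<4 ^ r i :: nat})))"
    unfolding boxes_def by (intro card_SigmaI finite_shapes ballI finite_PiE) auto
  also have "\<dots> = (\<Sum>r\<in>shapes q i0. 4 ^ (CARD('n) * q))"
    by (intro sum.cong refl) (simp add: card_PiE power_sum[symmetric] shapes_def)
  finally show ?thesis by (simp add: card_shapes)
qed

lemma boxesD:
  assumes "R \<in> boxes q (i0 :: 'n::finite)"
  shows "fst R \<in> shapes q i0" "snd R i < 4 ^ fst R i" "fst R i \<le> CARD('n) * q"
    "(\<Sum>i\<in>UNIV. fst R i) = CARD('n) * q"
  using assms shapes_le[of "fst R" q i0 i] by (auto simp: boxes_def shapes_def)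

lemma finite_grid: "finite (grid N)"
  unfolding grid_def by (intro finite_PiE) auto

lemma card_grid: "card (grid N :: ('n::finite \<Rightarrow> nat) set) = (4 ^ N) ^ CARD('n)"
  unfolding grid_def by (simp add: card_PiE)

lemma sum_grid_prod:
  fixes f :: "'n::finite \<Rightarrow> nat \<Rightarrow> real"
  shows "(\<Sum>x\<in>grid N. \<Prod>i\<in>UNIV. f i (x i)) = (\<Prod>i\<in>UNIV. \<Sum>a<4 ^ N. f i a)"
  unfolding grid_def by (subst prod_sum_PiE) auto

lemma box_biorthogonal:
  fixes R R' :: "'n::finite box"
  assumes "\<And>i. fst R i < N" "\<And>i. snd R i < 4 ^ fst R i" "\<And>i. fst R' i < N" "\<And>i. snd R' i < 4 ^ fst R' i"
  shows "(\<Sum>x\<in>grid N. box_zigzag N R x * box_qsign N R' x) = (if R' = R then \<Prod>i\<in>UNIV. 4 ^ (N - fst R i) / 8 else 0)"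
proof -
  have "(\<Sum>x\<in>grid N. box_zigzag N R x * box_qsign N R' x)
     = (\<Prod>i\<in>UNIV. if (fst R i, snd R i) = (fst R' i, snd R' i) then 4 ^ (N - fst R i) / 8 else 0)"
    unfolding box_zigzag_def box_qsign_def prod.distrib[symmetric]
      sum_grid_prod[where N = N and f = "\<lambda>i a. zigzag_at N (fst R i) (snd R i) a * qsign N (fst R' i) (snd R' i) a"]
    by (intro prod.cong refl zigzag_at_qsign_biorthogonal assms)
  also have "\<dots> = (if R' = R then \<Prod>i\<in>UNIV. 4 ^ (N - fst R i) / 8 else 0)"
  proof (cases "R' = R")
    case False
    then have "fst R' \<noteq> fst R \<or> snd R' \<noteq> snd R" by (auto simp: prod_eq_iff)
    then obtain i where "(fst R i, snd R i) \<noteq> (fst R' i, snd R' i)" by (metis ext prod.inject)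
    then show ?thesis using False by (intro trans[OF prod_zero]) auto
  qed auto
  finally show ?thesis .
qed

lemma sum_box_zigzag:
  fixes R :: "'n::finite box"
  assumes "\<And>i. fst R i < N" "\<And>i. snd R i < 4 ^ fst R i"
  shows "(\<Sum>x\<in>grid N. box_zigzag N R x) = 0"
  unfolding box_zigzag_def sum_grid_prod[where N = N and f = "\<lambda>i a. zigzag_at N (fst R i) (snd R i) a"]
  using sum_zigzag_at[OF assms] by simp

text \<open>The number of grid points in a box, the same for all boxes since their volumes
  agree.\<close>

lemma prod_box_size:
  assumes "R \<in> boxes q (i0 :: 'n::finite)" "N = CARD('n) * q + 1"
  shows "(\<Prod>i\<in>UNIV. (4::real) ^ (N - fst R i)) = (4 ^ N) ^ CARD('n) / 4 ^ (CARD('n) * q)"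
proof -
  have "(\<Prod>i\<in>UNIV. (4::real) ^ (N - fst R i)) = (\<Prod>i\<in>UNIV. 4 ^ N / 4 ^ fst R i)"
    using boxesD(3)[OF assms(1)] assms(2) by (intro prod.cong refl power_diff) (auto simp: le_SucI)
  also have "\<dots> = (4 ^ N) ^ CARD('n) / 4 ^ (\<Sum>i\<in>UNIV. fst R i)"
    by (simp add: prod_dividef power_sum)
  finally show ?thesis using boxesD(4)[OF assms(1)] by simp
qed

lemma abs_qsign_le: "\<bar>qsign N s l x\<bar> \<le> 1"
  by (simp add: qsign_def quarter_sign_def)

lemma abs_box_qsign_le: "\<bar>box_qsign N R x\<bar> \<le> 1"
  unfolding box_qsign_def abs_prod using abs_qsign_le by (intro prod_le_1) auto

lemma box_qsign_nonzeroD: "box_qsign N R x \<noteq> 0 \<Longrightarrow> x i div 4 ^ (N - fst R i) = snd R i"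
proof (rule ccontr)
  assume a: "box_qsign N R x \<noteq> 0" "x i div 4 ^ (N - fst R i) \<noteq> snd R i"
  then have "qsign N (fst R i) (snd R i) (x i) = 0" by (simp add: qsign_def)
  then have "box_qsign N R x = 0" unfolding box_qsign_def by (intro prod_zero) auto
  then show False using a by simp
qed

section \<open>Pairs of points in a common box\<close>

definition agree :: "nat \<Rightarrow> nat \<Rightarrow> nat \<Rightarrow> nat \<Rightarrow> bool" where
  "agree N x y e \<longleftrightarrow> x div 4 ^ (N - e) = y div 4 ^ (N - e)"

text \<open>A majorant of \<open>2 ^ (e - r)\<close> for the deepest level \<open>e\<close> of
  agreement. Summing over all levels of agreement instead of taking the deepest turns sums over
  \<open>y\<close> into geometric series. The base 2 lies between \<open>exp (1/2)\<close>, the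
  growth rate of the remainder up to polynomial factors, and 4, the rate at which agreement becomes
  rare.\<close>

definition agree_weight :: "nat \<Rightarrow> nat \<Rightarrow> nat \<Rightarrow> nat \<Rightarrow> real" where
  "agree_weight N r x y = (\<Sum>e\<in>{r..N}. if agree N x y e then 2 ^ (e - r) else 0)"

lemma sum_two_four: "(\<Sum>i\<le>M. 2 ^ i * 4 ^ (M - i)) = 2 * 4 ^ M - (2 :: real) ^ M"
proof (induction M)
  case (Suc M)
  have "(\<Sum>i\<le>M. 2 ^ i * 4 ^ (Suc M - i)) = (\<Sum>i\<le>M. 4 * (2 ^ i * (4 :: real) ^ (M - i)))"
    by (intro sum.cong refl) (simp add: Suc_diff_le)
  then show ?case by (simp add: sum_distrib_left[symmetric] Suc.IH)
qed simp

text \<open>Exactly \<open>4 ^ (N - e)\<close> points agree with \<open>x\<close> at level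
  \<open>e\<close>, so the weights \<open>2 ^ (e - r)\<close> give a geometric series of ratio
  1/2.\<close>

lemma sum_agree_weight:
  assumes "r \<le> N" "x < 4 ^ N"
  shows "(\<Sum>y<4 ^ N. agree_weight N r x y) \<le> 2 * 4 ^ (N - r)"
proof -
  have "(\<Sum>y<4 ^ N. agree_weight N r x y) = (\<Sum>e\<in>{r..N}. \<Sum>y<4 ^ N. if agree N x y e then 2 ^ (e - r) else 0)"
    unfolding agree_weight_def by (rule sum.swap)
  also have "\<dots> = (\<Sum>e\<in>{r..N}. 2 ^ (e - r) * 4 ^ (N - e))"
  proof (intro sum.cong refl)
    fix e assume e: "e \<in> {r..N}"
    have "(4::nat) ^ N = 4 ^ e * 4 ^ (N - e)" using e by (simp add: power_add[symmetric])
    then have "x div 4 ^ (N - e) < 4 ^ e" using assms(2) by (simp add: div_less_iff_less_mult)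
    then have "(\<Sum>y<4 ^ N. if y div 4 ^ (N - e) = x div 4 ^ (N - e) then (2::real) ^ (e - r) else 0) = (\<Sum>t<(4::nat) ^ (N - e). 2 ^ (e - r))"
      using e by (intro sum_block) auto
    then show "(\<Sum>y<4 ^ N. if agree N x y e then (2::real) ^ (e - r) else 0) = 2 ^ (e - r) * 4 ^ (N - e)"
      by (simp add: agree_def eq_commute[of "x div _"] mult.commute)
  qed
  also have "\<dots> = (\<Sum>i\<le>N - r. 2 ^ i * 4 ^ (N - r - i))"
    by (rule sum.reindex_bij_witness[where i = "\<lambda>i. i + r" and j = "\<lambda>e. e - r"]) (use assms(1) in auto)
  also have "\<dots> \<le> 2 * 4 ^ (N - r)" unfolding sum_two_four by simp
  finally show ?thesis .
qed

lemma sum_agree_weight_box: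
  assumes "r \<le> N" "j < 4 ^ r"
  shows "(\<Sum>x<4 ^ N. \<Sum>y<4 ^ N. (if x div 4 ^ (N - r) = j then agree_weight N r x y else 0)) \<le> 2 * (4 ^ (N - r))\<^sup>2"
proof -
  have "(\<Sum>x<4 ^ N. \<Sum>y<4 ^ N. (if x div 4 ^ (N - r) = j then agree_weight N r x y else 0))
     \<le> (\<Sum>x<4 ^ N. if x div 4 ^ (N - r) = j then 2 * 4 ^ (N - r) else 0)"
    using sum_agree_weight[OF assms(1)] by (intro sum_mono) auto
  also have "\<dots> = (\<Sum>t<(4::nat) ^ (N - r). 2 * 4 ^ (N - r))"
    using assms by (intro sum_block) auto
  finally show ?thesis by (simp add: power2_eq_square)
qed

text \<open>
  If \<open>x\<close> and \<open>y\<close> lie in a common box of shape \<open>r\<close> and separate only \<open>s\<close> levels later, counted over all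
  coordinates, then the levels of any other common box differ from \<open>r\<close> by at most \<open>s\<close>. This makes the
  values of the random sum at typical points of a box nearly independent.
\<close>

lemma card_common_boxes:
  fixes i0 :: "'n::finite" and e :: "'n \<Rightarrow> nat"
  assumes r: "r \<in> shapes q i0" "\<And>i. r i \<le> e i" and s: "s = (\<Sum>i\<in>UNIV. e i - r i)"
    and B: "B \<subseteq> boxes q i0" "\<And>R i. R \<in> B \<Longrightarrow> fst R i \<le> e i"
      "\<And>R i. R \<in> B \<Longrightarrow> snd R i = x i div 4 ^ (N - fst R i)"
  shows "card B \<le> (min q (s + 1)) ^ (CARD('n) - 1)"
proof -
  define W where "W = (\<lambda>i. {p. p < q \<and> e i \<le> p + s \<and> p \<le> e i})"
  have fW: "finite (W i)" for i by (rule finite_subset[of _ "{..<q}"]) (auto simp: W_def)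
  have cW: "card (W i) \<le> min q (s + 1)" for i
  proof -
    have "card (W i) \<le> card {..<q}" by (intro card_mono) (auto simp: W_def)
    moreover have "card (W i) \<le> card {e i - s..e i}" by (intro card_mono) (auto simp: W_def)
    ultimately show ?thesis by auto
  qed
  \<comment> \<open>The levels of all boxes have the same total. One level can therefore drop below
    \<open>r i\<close> only by what the other levels gain, and those cannot exceed
    \<open>e\<close>.\<close>
  have lower: "e i \<le> fst R i + s" if "R \<in> B" for R i
  proof -
    have "(\<Sum>k\<in>UNIV. fst R k) = (\<Sum>k\<in>UNIV. r k)"
      using boxesD(4)[of R q i0] B(1) that r(1) by (auto simp: shapes_def)
    then have 1: "fst R i + (\<Sum>k\<in>UNIV - {i}. fst R k) = r i + (\<Sum>k\<in>UNIV - {i}. r k)"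
      by (simp add: sum.remove[of UNIV i])
    have "(\<Sum>k\<in>UNIV - {i}. fst R k) \<le> (\<Sum>k\<in>UNIV - {i}. r k + (e k - r k))"
      using B(2)[OF that] r(2) by (intro sum_mono) simp
    moreover have "s = (e i - r i) + (\<Sum>k\<in>UNIV - {i}. e k - r k)"
      unfolding s by (simp add: sum.remove[of UNIV i])
    ultimately show ?thesis using 1 r(2)[of i] by (simp add: sum.distrib)
  qed
  have "card B \<le> card (PiE (UNIV - {i0}) W)"
  proof (rule card_inj_on_le[where f = "\<lambda>R. restrict (fst R) (UNIV - {i0})"])
    show "inj_on (\<lambda>R. restrict (fst R) (UNIV - {i0})) B"
    proof (rule inj_onI)
      fix R R' assume R: "R \<in> B" "R' \<in> B" "restrict (fst R) (UNIV - {i0}) = restrict (fst R') (UNIV - {i0})"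
      then have "fst R \<in> shapes q i0" "fst R' \<in> shapes q i0" using B(1) boxesD(1) by blast+
      then have f: "fst R = fst R'"
        using R(3) bij_betw_imp_inj_on[OF bij_betw_shapes[of i0 q]] by (auto dest: inj_onD)
      moreover have "snd R = snd R'" using B(3)[OF R(1)] B(3)[OF R(2)] f by (intro ext) simp
      ultimately show "R = R'" by (simp add: prod_eq_iff)
    qed
    show "(\<lambda>R. restrict (fst R) (UNIV - {i0})) ` B \<subseteq> PiE (UNIV - {i0}) W"
    proof (rule image_subsetI)
      fix R assume R: "R \<in> B"
      then have "fst R \<in> shapes q i0" using B(1) boxesD(1) by blast
      then show "restrict (fst R) (UNIV - {i0}) \<in> PiE (UNIV - {i0}) W"
        using lower[OF R] B(2)[OF R] by (auto simp: W_def shapes_def)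
    qed
    show "finite (PiE (UNIV - {i0}) W)" using fW by (intro finite_PiE) auto
  qed
  also have "\<dots> = (\<Prod>i\<in>UNIV - {i0}. card (W i))" by (simp add: card_PiE)
  also have "\<dots> \<le> (\<Prod>i\<in>UNIV - {i0}. min q (s + 1))" using cW by (intro prod_mono) auto
  finally show ?thesis by (simp add: card_Diff_singleton)
qed

section \<open>The remainder of the second moment\<close>

lemma abs_riesz_rest_le:
  fixes \<delta> :: real and x y :: 'x and k :: "'r \<Rightarrow> 'x \<Rightarrow> real"
  assumes "finite I" "\<And>R x. \<bar>k R x\<bar> \<le> 1"
  defines "S \<equiv> \<delta>\<^sup>2 * real (card {R\<in>I. k R x \<noteq> 0 \<and> k R y \<noteq> 0})"
  shows "\<bar>riesz_rest \<delta> I k x y\<bar> \<le> S\<^sup>2 * exp S"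
proof -
  define A where "A = (\<Sum>R\<in>I. \<bar>\<delta>\<^sup>2 * (k R x * k R y)\<bar>)"
  have "A \<le> (\<Sum>R\<in>I. if k R x \<noteq> 0 \<and> k R y \<noteq> 0 then \<delta>\<^sup>2 else 0)"
    unfolding A_def
  proof (rule sum_mono)
    fix R
    have "\<bar>k R x * k R y\<bar> \<le> 1 * 1" unfolding abs_mult using assms(2) by (intro mult_mono) auto
    then have "\<delta>\<^sup>2 * \<bar>k R x * k R y\<bar> \<le> \<delta>\<^sup>2 * 1" by (intro mult_left_mono) auto
    then show "\<bar>\<delta>\<^sup>2 * (k R x * k R y)\<bar> \<le> (if k R x \<noteq> 0 \<and> k R y \<noteq> 0 then \<delta>\<^sup>2 else 0)"
      by (auto simp: abs_mult)
  qed
  also have "\<dots> = (\<Sum>R\<in>{R\<in>I. k R x \<noteq> 0 \<and> k R y \<noteq> 0}. \<delta>\<^sup>2)"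
    using assms(1) by (subst sum.inter_filter) auto
  finally have AS: "A \<le> S" by (simp add: S_def mult.commute)
  have A0: "0 \<le> A" unfolding A_def by (intro sum_nonneg) simp
  have "\<bar>riesz_rest \<delta> I k x y\<bar> \<le> exp A - 1 - A"
    unfolding riesz_rest_def A_def by (rule abs_prod_one_plus_le(2)[OF assms(1)])
  also have "\<dots> \<le> A\<^sup>2 * exp A" by (rule exp_second_order_le[OF A0])
  also have "\<dots> \<le> S\<^sup>2 * exp S" using A0 AS by (intro mult_mono power_mono) auto
  finally show ?thesis .
qed

text \<open>The number of boxes common to \<open>x\<close> and \<open>y\<close> is estimated in two
  ways. In the exponential all but one of the \<open>d - 1\<close> factors
  \<open>min q (s + 1)\<close> are bounded by \<open>q\<close>, and the choice of \<delta> leaves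
  \<open>(s + 1) / 2\<close>, free of \<open>q\<close>. In the square all of them are bounded by
  \<open>s + 1\<close>, which keeps the full factor \<open>\<delta>^4\<close>. Both bounds grow
  slowly enough in \<open>s\<close> to be absorbed by \<open>2 ^ s\<close>.\<close>

lemma box_riesz_rest_le:
  fixes i0 :: "'n::finite"
  assumes d: "2 \<le> CARD('n)" and q: "1 \<le> q" and N: "N = CARD('n) * q + 1"
    and \<delta>: "\<delta>\<^sup>2 = 1 / (2 * real q ^ (CARD('n) - 2))"
    and D: "\<And>s :: nat. real (s + 1) ^ (2 * (CARD('n) - 1)) * exp (real (s + 1) / 2) \<le> D * 2 ^ s"
    and R: "R \<in> boxes q i0"
    and x: "\<And>i. x i div 4 ^ (N - fst R i) = snd R i" and y: "\<And>i. y i div 4 ^ (N - fst R i) = snd R i"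
  shows "\<bar>riesz_rest \<delta> (boxes q i0) (box_qsign N) x y\<bar>
     \<le> \<delta> ^ 4 * D * (\<Prod>i\<in>UNIV. agree_weight N (fst R i) (x i) (y i))"
proof -
  let ?d = "CARD('n)"
  \<comment> \<open>The deepest level at which the two points share an interval in coordinate
    \<open>i\<close>; the level of \<open>R\<close> itself qualifies, so the maximum is over a
    nonempty set.\<close>
  define e where "e = (\<lambda>i. Max {e. e \<le> N \<and> agree N (x i) (y i) e})"
  have fin: "finite {e. e \<le> N \<and> agree N (x i) (y i) e}" for i by simp
  have rN: "fst R i \<le> N" for i using boxesD(3)[OF R] N by (simp add: le_SucI)
  have rin: "fst R i \<in> {e. e \<le> N \<and> agree N (x i) (y i) e}" for i
    using rN x y by (simp add: agree_def)
  have re: "fst R i \<le> e i" for i unfolding e_def using fin rin by (intro Max_ge) auto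
  have ein: "e i \<le> N" "agree N (x i) (y i) (e i)" for i
    using Max_in[OF fin[of i]] rin[of i] unfolding e_def by (auto simp only: mem_Collect_eq empty_iff)
  define s where "s = (\<Sum>i\<in>UNIV. e i - fst R i)"
  define B where "B = {R'\<in>boxes q i0. box_qsign N R' x \<noteq> 0 \<and> box_qsign N R' y \<noteq> 0}"
  have cB: "card B \<le> (min q (s + 1)) ^ (?d - 1)"
  proof (rule card_common_boxes[OF boxesD(1)[OF R] re s_def])
    show "B \<subseteq> boxes q i0" by (auto simp: B_def)
    fix R' i assume R': "R' \<in> B"
    then have b: "x i div 4 ^ (N - fst R' i) = snd R' i" "y i div 4 ^ (N - fst R' i) = snd R' i"
      by (auto simp: B_def dest: box_qsign_nonzeroD)
    then show "snd R' i = x i div 4 ^ (N - fst R' i)" by simp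
    have "fst R' i \<le> N" using boxesD(3)[of R' q i0 i] R' N by (auto simp: B_def)
    then show "fst R' i \<le> e i" unfolding e_def using fin b by (intro Max_ge) (auto simp: agree_def)
  qed
  define S where "S = \<delta>\<^sup>2 * real (card B)"
  have S0: "0 \<le> S" by (simp add: S_def)
  have dd: "?d - 1 = Suc (?d - 2)" using d by simp
  have S1: "S \<le> real (s + 1) / 2"
  proof -
    have "real (card B) \<le> real ((min q (s + 1)) ^ (?d - 1))" using cB by (simp only: of_nat_le_iff)
    also have "\<dots> = real (min q (s + 1)) ^ (?d - 2) * real (min q (s + 1))" by (simp only: dd of_nat_power power_Suc2 of_nat_mult)
    also have "\<dots> \<le> real q ^ (?d - 2) * real (s + 1)" by (intro mult_mono power_mono) auto
    finally have "S \<le> \<delta>\<^sup>2 * (real q ^ (?d - 2) * real (s + 1))" unfolding S_def by (intro mult_left_mono) auto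
    then show ?thesis using q by (simp add: \<delta>)
  qed
  have S2: "S \<le> \<delta>\<^sup>2 * real (s + 1) ^ (?d - 1)"
  proof -
    have "(min q (s + 1)) ^ (?d - 1) \<le> (s + 1) ^ (?d - 1)" by (intro power_mono) auto
    then have "real (card B) \<le> real ((s + 1) ^ (?d - 1))" using cB by (simp only: of_nat_le_iff)
    then show ?thesis unfolding S_def by (intro mult_left_mono) auto
  qed
  have "\<bar>riesz_rest \<delta> (boxes q i0) (box_qsign N) x y\<bar> \<le> S\<^sup>2 * exp S"
    unfolding S_def B_def by (rule abs_riesz_rest_le[OF finite_boxes abs_box_qsign_le])
  also have "\<dots> \<le> (\<delta>\<^sup>2 * real (s + 1) ^ (?d - 1))\<^sup>2 * exp (real (s + 1) / 2)"
    using S0 S1 S2 by (intro mult_mono power_mono) auto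
  also have "\<dots> = \<delta> ^ 4 * (real (s + 1) ^ (2 * (?d - 1)) * exp (real (s + 1) / 2))"
    by (simp only: power_mult_distrib power_mult[symmetric]) (simp add: mult.commute)
  also have "\<dots> \<le> \<delta> ^ 4 * (D * 2 ^ s)" by (intro mult_left_mono D) auto
  also have "\<dots> \<le> \<delta> ^ 4 * (D * (\<Prod>i\<in>UNIV. agree_weight N (fst R i) (x i) (y i)))"
  proof (intro mult_left_mono)
    have "(2::real) ^ s = (\<Prod>i\<in>UNIV. 2 ^ (e i - fst R i))" by (simp add: s_def power_sum)
    also have "\<dots> \<le> (\<Prod>i\<in>UNIV. agree_weight N (fst R i) (x i) (y i))"
    proof (intro prod_mono conjI)
      fix i
      have "(if agree N (x i) (y i) (e i) then 2 ^ (e i - fst R i) else 0) \<le> agree_weight N (fst R i) (x i) (y i)"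
        unfolding agree_weight_def using ein[of i] re[of i] by (intro member_le_sum) auto
      then show "2 ^ (e i - fst R i) \<le> agree_weight N (fst R i) (x i) (y i)" using ein[of i] by simp
    qed simp
    finally show "(2::real) ^ s \<le> (\<Prod>i\<in>UNIV. agree_weight N (fst R i) (x i) (y i))" .
    have "0 \<le> real (0 + 1) ^ (2 * (?d - 1)) * exp (real (0 + 1) / 2)" by simp
    also have "\<dots> \<le> D" using D[of 0] by simp
    finally show "0 \<le> D" .
  qed simp
  finally show ?thesis by (simp add: mult.assoc)
qed

lemma sum_box_riesz_rest_le:
  fixes i0 :: "'n::finite"
  assumes d: "2 \<le> CARD('n)" and q: "1 \<le> q" and N: "N = CARD('n) * q + 1"
    and \<delta>: "\<delta>\<^sup>2 = 1 / (2 * real q ^ (CARD('n) - 2))"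
    and D: "\<And>s :: nat. real (s + 1) ^ (2 * (CARD('n) - 1)) * exp (real (s + 1) / 2) \<le> D * 2 ^ s"
    and R: "R \<in> boxes q i0"
  shows "(\<Sum>x\<in>grid N. \<Sum>y\<in>grid N. \<bar>box_zigzag N R x\<bar> * \<bar>box_zigzag N R y\<bar> * \<bar>riesz_rest \<delta> (boxes q i0) (box_qsign N) x y\<bar>)
     \<le> \<delta> ^ 4 * D * (2 ^ CARD('n) * (\<Prod>i\<in>UNIV. 4 ^ (N - fst R i))\<^sup>2)"
proof -
  define ind where "ind = (\<lambda>i a. if a div 4 ^ (N - fst R i) = snd R i then 1 else 0 :: real)"
  \<comment> \<open>A majorant that is a product over the coordinates, so that the double sum over
    the grid factorises into one-dimensional double sums.\<close>
  define \<phi> where "\<phi> = (\<lambda>i a b. if a div 4 ^ (N - fst R i) = snd R i then agree_weight N (fst R i) a b else 0)"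
  have D0: "0 \<le> D"
  proof -
    have "0 \<le> real (0 + 1) ^ (2 * (CARD('n) - 1)) * exp (real (0 + 1) / 2)" by simp
    also have "\<dots> \<le> D" using D[of 0] by simp
    finally show ?thesis .
  qed
  have aw: "0 \<le> agree_weight N r a b" for r a b unfolding agree_weight_def by (intro sum_nonneg) auto
  have \<phi>0: "0 \<le> \<phi> i a b" for i a b using aw by (simp add: \<phi>_def)
  have pt: "\<bar>box_zigzag N R x\<bar> * \<bar>box_zigzag N R y\<bar> * \<bar>riesz_rest \<delta> (boxes q i0) (box_qsign N) x y\<bar>
      \<le> \<delta> ^ 4 * D * (\<Prod>i\<in>UNIV. \<phi> i (x i) (y i))" for x y
  proof (cases "\<forall>i. x i div 4 ^ (N - fst R i) = snd R i \<and> y i div 4 ^ (N - fst R i) = snd R i")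
    case True
    have t: "\<bar>box_zigzag N R z\<bar> \<le> 1" for z
    proof -
      have "\<bar>zigzag_at N (fst R i) (snd R i) (z i)\<bar> \<le> 1" for i
        using abs_zigzag_at_le[of N "fst R i" "snd R i" "z i"] by (auto split: if_splits)
      then show ?thesis unfolding box_zigzag_def abs_prod by (intro prod_le_1) auto
    qed
    have "\<bar>box_zigzag N R x\<bar> * \<bar>box_zigzag N R y\<bar> * \<bar>riesz_rest \<delta> (boxes q i0) (box_qsign N) x y\<bar>
       \<le> 1 * 1 * \<bar>riesz_rest \<delta> (boxes q i0) (box_qsign N) x y\<bar>"
      using t by (intro mult_mono) auto
    also have "\<dots> \<le> \<delta> ^ 4 * D * (\<Prod>i\<in>UNIV. agree_weight N (fst R i) (x i) (y i))"
      using box_riesz_rest_le[OF d q N \<delta> D R, of x y] True by simp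
    finally show ?thesis using True by (simp add: \<phi>_def)
  next
    case False
    then obtain i where "x i div 4 ^ (N - fst R i) \<noteq> snd R i \<or> y i div 4 ^ (N - fst R i) \<noteq> snd R i" by blast
    then have "zigzag_at N (fst R i) (snd R i) (x i) = 0 \<or> zigzag_at N (fst R i) (snd R i) (y i) = 0"
      using zigzag_at_outside by blast
    then have "box_zigzag N R x = 0 \<or> box_zigzag N R y = 0"
      unfolding box_zigzag_def by auto
    then have "\<bar>box_zigzag N R x\<bar> * \<bar>box_zigzag N R y\<bar> * \<bar>riesz_rest \<delta> (boxes q i0) (box_qsign N) x y\<bar> = 0" by auto
    also have "0 \<le> \<delta> ^ 4 * D * (\<Prod>i\<in>UNIV. \<phi> i (x i) (y i))"
      using D0 \<phi>0 by (intro mult_nonneg_nonneg prod_nonneg) auto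
    finally show ?thesis .
  qed
  have "(\<Sum>x\<in>grid N. \<Sum>y\<in>grid N. \<bar>box_zigzag N R x\<bar> * \<bar>box_zigzag N R y\<bar> * \<bar>riesz_rest \<delta> (boxes q i0) (box_qsign N) x y\<bar>)
     \<le> (\<Sum>x\<in>grid N. \<Sum>y\<in>grid N. \<delta> ^ 4 * D * (\<Prod>i\<in>UNIV. \<phi> i (x i) (y i)))"
    by (intro sum_mono pt)
  also have "\<dots> = \<delta> ^ 4 * D * (\<Sum>x\<in>grid N. \<Sum>y\<in>grid N. \<Prod>i\<in>UNIV. \<phi> i (x i) (y i))"
    by (simp only: sum_distrib_left)
  also have "(\<Sum>x\<in>grid N. \<Sum>y\<in>grid N. \<Prod>i\<in>UNIV. \<phi> i (x i) (y i)) = (\<Prod>i\<in>UNIV. \<Sum>a<4 ^ N. \<Sum>b<4 ^ N. \<phi> i a b)"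
  proof -
    have "(\<Sum>y\<in>grid N. \<Prod>i\<in>UNIV. \<phi> i (x i) (y i)) = (\<Prod>i\<in>UNIV. \<Sum>b<4 ^ N. \<phi> i (x i) b)" for x
      by (rule sum_grid_prod[where N = N and f = "\<lambda>i b. \<phi> i (x i) b"])
    then show ?thesis using sum_grid_prod[where N = N and f = "\<lambda>i a. \<Sum>b<4 ^ N. \<phi> i a b"] by (simp only:)
  qed
  also have "\<delta> ^ 4 * D * \<dots> \<le> \<delta> ^ 4 * D * (\<Prod>i\<in>UNIV. 2 * (4 ^ (N - fst R i))\<^sup>2)"
  proof (intro mult_left_mono prod_mono conjI)
    fix i
    show "0 \<le> (\<Sum>a<4 ^ N. \<Sum>b<4 ^ N. \<phi> i a b)" by (intro sum_nonneg \<phi>0)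
    show "(\<Sum>a<4 ^ N. \<Sum>b<4 ^ N. \<phi> i a b) \<le> 2 * (4 ^ (N - fst R i))\<^sup>2"
      unfolding \<phi>_def using boxesD(3)[OF R, of i] N boxesD(2)[OF R, of i] by (intro sum_agree_weight_box) auto
  qed (use D0 in auto)
  also have "(\<Prod>i\<in>UNIV. 2 * ((4::real) ^ (N - fst R i))\<^sup>2) = 2 ^ CARD('n) * (\<Prod>i\<in>UNIV. 4 ^ (N - fst R i))\<^sup>2"
    by (simp add: prod.distrib prod_power_distrib)
  finally show ?thesis .
qed

section \<open>The small ball inequality on half of the boxes\<close>

lemma power_le_fact_exp:
  fixes x :: real
  assumes "0 \<le> x"
  shows "x ^ k \<le> fact k * exp x"
proof -
  have "sum (\<lambda>n. x ^ n /\<^sub>R fact n) {k} \<le> suminf (\<lambda>n. x ^ n /\<^sub>R fact n)"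
    using assms summable_exp_generic[of x] by (intro sum_le_suminf) auto
  then have "x ^ k / fact k \<le> exp x" by (simp add: exp_def divide_inverse mult.commute)
  then show ?thesis by (simp add: field_simps)
qed

lemma power_exp_le_two_power:
  obtains D :: real where "0 < D" "\<And>s :: nat. real (s + 1) ^ k * exp (real (s + 1) / 2) \<le> D * 2 ^ s"
proof -
  \<comment> \<open>The polynomial is absorbed into \<open>exp (z / 10)\<close>, which is affordable
    because 1/10 + 1/2 = 3/5 is below \<open>ln 2\<close>. The last factor 2 accounts for
    \<open>2 ^ (s + 1)\<close> against \<open>2 ^ s\<close>.\<close>
  define D :: real where "D = fact k * 10 ^ k * 2"
  have "real (s + 1) ^ k * exp (real (s + 1) / 2) \<le> D * 2 ^ s" for s
  proof -
    define z :: real where "z = real (s + 1)"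
    have z0: "0 \<le> z" by (simp add: z_def)
    have "(z / 10) ^ k \<le> fact k * exp (z / 10)" by (rule power_le_fact_exp) (use z0 in simp)
    then have "z ^ k \<le> fact k * 10 ^ k * exp (z / 10)" by (simp add: power_divide field_simps)
    then have "z ^ k * exp (z / 2) \<le> fact k * 10 ^ k * exp (z / 10) * exp (z / 2)"
      by (rule mult_right_mono) simp
    also have "\<dots> = fact k * 10 ^ k * exp (z / 10 + z / 2)" by (simp only: exp_add mult.assoc)
    also have "\<dots> \<le> fact k * 10 ^ k * exp (z * ln 2)"
      using z0 ln2_ge_two_thirds mult_left_mono[of "3/5" "ln 2" z] by (intro mult_left_mono) auto
    also have "exp (z * ln 2) = 2 ^ (s + 1)"
      unfolding z_def by (subst exp_of_nat_mult) simp
    finally show ?thesis by (simp add: D_def z_def)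
  qed
  then show ?thesis using that[of D] by (simp add: D_def)
qed

text \<open>With \<open>V\<close> grid points in a box, each coefficient contributes a main term of
  order \<open>\<delta> * V\<close> and an error of order \<open>\<delta>^2 * V\<close>, so for
  large \<open>q\<close> at least half of the main term survives. Dividing by the number of grid
  points leaves \<delta> times the number of shapes, that is
  \<open>q ^ (1 - d/2) * q ^ (d - 1) = q ^ (d/2)\<close> up to constants.\<close>

lemma box_zigzag_small_ball:
  assumes d: "3 \<le> CARD('n::finite)"
  obtains c q0 where "0 < c" "1 \<le> q0"
    "\<And>q (i0 :: 'n). q0 \<le> q \<Longrightarrow> \<exists>T\<subseteq>boxes q i0. card (boxes q i0) \<le> 2 * card T \<and>
      (\<forall>S \<gamma> H. S \<subseteq> T \<longrightarrow> (\<forall>R\<in>S. \<bar>\<gamma> R\<bar> = 1) \<longrightarrow> card T \<le> 16 * card S \<longrightarrow>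
        (\<forall>x\<in>grid (CARD('n) * q + 1). \<bar>\<Sum>R\<in>S. \<gamma> R * box_zigzag (CARD('n) * q + 1) R x\<bar> \<le> H) \<longrightarrow>
        c * sqrt (real q ^ CARD('n)) \<le> H)"
proof -
  let ?d = "CARD('n)"
  obtain D where D: "0 < D" "\<And>s :: nat. real (s + 1) ^ (2 * (?d - 1)) * exp (real (s + 1) / 2) \<le> D * 2 ^ s"
    using power_exp_le_two_power[of "2 * (?d - 1)"] by blast
  \<comment> \<open>Chosen so that \<open>q >= L\<close> makes the error at most half of the main
    term.\<close>
  define L where "L = (32 * 8 ^ ?d)\<^sup>2 * (D * 2 ^ ?d)"
  have L0: "0 < L" using D(1) by (simp add: L_def)
  define q0 where "q0 = max 1 (nat \<lceil>L\<rceil>)"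
  \<comment> \<open>Here 512 is 2 for the surviving half of the main term, times 32 since
    \<open>S\<close> has at least 1/32 of the boxes, times 8 for the mass of the Riesz product. The
    factor \<open>8 ^ d\<close> stems from the one-dimensional pairing and \<open>sqrt 2\<close>
    from \<delta>.\<close>
  define c :: real where "c = 1 / (512 * 8 ^ ?d * sqrt 2)"
  show ?thesis
  proof (rule that[of c q0])
    show "0 < c" by (simp add: c_def)
    show "1 \<le> q0" by (simp add: q0_def)
    fix q and i0 :: 'n
    assume "q0 \<le> q"
    then have q: "1 \<le> q" "L \<le> real q" by (auto simp: q0_def)
    define N where "N = ?d * q + 1"
    define n where "n = ?d * q"
    define \<delta> where "\<delta> = sqrt (1 / (2 * real q ^ (?d - 2)))"
    have \<delta>2: "\<delta>\<^sup>2 = 1 / (2 * real q ^ (?d - 2))" by (simp add: \<delta>_def)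
    have \<delta>0: "0 < \<delta>" using q by (simp add: \<delta>_def)
    \<comment> \<open>This is where \<open>d >= 3\<close> enters: for \<open>d = 2\<close> the value
      of \<delta> would not decrease with \<open>q\<close>.\<close>
    have qpow: "real q \<le> real q ^ (?d - 2)" using d q power_increasing[of 1 "?d - 2" "real q"] by simp
    have \<delta>1: "\<delta>\<^sup>2 \<le> 1 / real q"
    proof -
      have "real q \<le> 2 * real q ^ (?d - 2)" using qpow q by linarith
      moreover have "0 < real q" using q by simp
      ultimately show ?thesis unfolding \<delta>2 by (intro divide_left_mono mult_pos_pos) auto
    qed
    have "\<delta>\<^sup>2 \<le> 1" using \<delta>1 q by (simp add: order.trans)
    then have \<delta>le: "\<delta> \<le> 1" using \<delta>0 by (simp add: power_le_one_iff)
    define V :: real where "V = (4 ^ N) ^ ?d / 4 ^ n"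
    have V0: "0 < V" by (simp add: V_def)
    define E where "E = \<delta> ^ 4 * D * (2 ^ ?d * V\<^sup>2)"
    have E0: "0 < E" using \<delta>0 D V0 by (simp add: E_def)
    have prodV: "(\<Prod>i\<in>UNIV. (4::real) ^ (N - fst R i)) = V" if "R \<in> boxes q i0" for R
      using prod_box_size[OF that N_def] by (simp add: V_def n_def)
    have lvl: "fst R i < N" "snd R i < 4 ^ fst R i" if "R \<in> boxes q i0" for R i
      using boxesD(2,3)[OF that, of i] by (auto simp: N_def)
    have neI: "boxes q i0 \<noteq> {}"
    proof -
      have "0 < card (boxes q i0)" unfolding card_boxes using q by simp
      then show ?thesis by force
    qed
    have cX: "real (card (grid N :: ('n \<Rightarrow> nat) set)) = V * 4 ^ n"
      by (simp add: card_grid V_def)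
    have neX: "(grid N :: ('n \<Rightarrow> nat) set) \<noteq> {}"
      using cX V0 by force
    obtain T where T: "T \<subseteq> boxes q i0" "card (boxes q i0) \<le> 2 * card T"
      and small: "\<And>\<gamma> S H. S \<subseteq> T \<Longrightarrow> (\<And>R. R \<in> S \<Longrightarrow> \<bar>\<gamma> R\<bar> = 1) \<Longrightarrow>
       (\<And>x. x \<in> grid N \<Longrightarrow> \<bar>\<Sum>R\<in>S. \<gamma> R * box_zigzag N R x\<bar> \<le> H) \<Longrightarrow>
       \<delta> * (V / 8 ^ ?d) * real (card S) - sqrt (real (card S)) * sqrt (8 * real (card (boxes q i0)) * E)
       \<le> 8 * real (card (grid N :: ('n \<Rightarrow> nat) set)) * H"
    proof (rule biorthogonal_small_ball[OF finite_boxes finite_grid neI neX, where u = "box_zigzag N" and k = "box_qsign N" and \<delta> = \<delta> and E = E and C = "V / 8 ^ ?d"])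
      show "(\<Sum>x\<in>grid N. box_zigzag N R x * box_qsign N R' x) = (if R' = R then V / 8 ^ ?d else 0)"
        if "R \<in> boxes q i0" "R' \<in> boxes q i0" for R R'
        using box_biorthogonal[of R N R'] lvl[OF that(1)] lvl[OF that(2)] prodV[OF that(1)] by (simp add: prod_dividef)
      show "(\<Sum>x\<in>grid N. box_zigzag N R x) = 0" if "R \<in> boxes q i0" for R
        using lvl[OF that] by (intro sum_box_zigzag)
      show "(\<Sum>x\<in>grid N. \<Sum>y\<in>grid N. \<bar>box_zigzag N R x\<bar> * \<bar>box_zigzag N R y\<bar> * \<bar>riesz_rest \<delta> (boxes q i0) (box_qsign N) x y\<bar>) \<le> E"
        if "R \<in> boxes q i0" for R
        using sum_box_riesz_rest_le[OF _ q(1) N_def \<delta>2 D(2) that] d prodV[OF that] by (simp add: E_def)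
    qed (use abs_box_qsign_le \<delta>0 \<delta>le E0 in auto)
    have "c * sqrt (real q ^ ?d) \<le> H"
      if S: "S \<subseteq> T" "\<forall>R\<in>S. \<bar>\<gamma> R\<bar> = 1" "card T \<le> 16 * card S"
        and H: "\<forall>x\<in>grid N. \<bar>\<Sum>R\<in>S. \<gamma> R * box_zigzag N R x\<bar> \<le> H" for S \<gamma> H
    proof -
      define s where "s = real (card S)"
      define M where "M = real (card (boxes q i0))"
      define G where "G = sqrt (D * 2 ^ ?d)"
      have G0: "0 \<le> G" using D(1) by (simp add: G_def)
      have Ms: "M \<le> 32 * s" using T(2) S(3) by (simp add: M_def s_def)
      have M: "M = real q ^ (?d - 1) * 4 ^ n" by (simp add: M_def card_boxes n_def)
      have s0: "0 \<le> s" by (simp add: s_def)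
      have main: "\<delta> * (V / 8 ^ ?d) * s - sqrt s * sqrt (8 * M * E) \<le> 8 * (V * 4 ^ n) * H"
        unfolding s_def M_def cX[symmetric] by (rule small) (use S H in auto)
      have "sqrt s * sqrt (8 * M * E) = sqrt (s * (8 * M * E))" by (simp add: real_sqrt_mult)
      also have "\<dots> \<le> sqrt (s * (8 * (32 * s) * E))"
        using s0 E0 Ms by (intro real_sqrt_le_mono mult_left_mono mult_right_mono) auto
      also have "s * (8 * (32 * s) * E) = (16 * s * \<delta>\<^sup>2 * V * G)\<^sup>2"
      proof -
        have "G\<^sup>2 = D * 2 ^ ?d" using D(1) by (simp add: G_def)
        then show ?thesis by (simp add: E_def power_mult_distrib power2_eq_square power4_eq_xxxx algebra_simps)
      qed
      also have "sqrt \<dots> = 16 * s * \<delta>\<^sup>2 * V * G" using s0 V0 G0 by simp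
      finally have err: "sqrt s * sqrt (8 * M * E) \<le> 16 * s * \<delta>\<^sup>2 * V * G" .
      have \<delta>G: "\<delta> * G * (32 * 8 ^ ?d) \<le> 1"
      proof -
        have "(\<delta> * G * (32 * 8 ^ ?d))\<^sup>2 = \<delta>\<^sup>2 * L"
          using D(1) by (simp add: G_def L_def power_mult_distrib)
        also have "\<dots> \<le> (1 / real q) * real q" using \<delta>1 q L0 by (intro mult_mono) auto
        also have "\<dots> = 1" using q by simp
        finally have "(\<delta> * G * (32 * 8 ^ ?d))\<^sup>2 \<le> 1\<^sup>2" by simp
        then show ?thesis by (rule power2_le_imp_le) simp
      qed
      have "16 * s * \<delta>\<^sup>2 * V * G = (\<delta> * V * s / (2 * 8 ^ ?d)) * (\<delta> * G * (32 * 8 ^ ?d))"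
        by (simp add: power2_eq_square)
      also have "\<dots> \<le> (\<delta> * V * s / (2 * 8 ^ ?d)) * 1"
        using \<delta>G \<delta>0 V0 s0 by (intro mult_left_mono) auto
      finally have "sqrt s * sqrt (8 * M * E) \<le> \<delta> * V * s / (2 * 8 ^ ?d)"
        using err by (simp only: mult_1_right)
      then have "\<delta> * (V / 8 ^ ?d) * s - \<delta> * V * s / (2 * 8 ^ ?d) \<le> 8 * (V * 4 ^ n) * H"
        by (rule order.trans[OF diff_left_mono main])
      then have "V * (\<delta> * s / (2 * 8 ^ ?d)) \<le> V * (8 * 4 ^ n * H)"
        by (simp add: field_simps)
      then have 1: "\<delta> * s / (2 * 8 ^ ?d) \<le> 8 * 4 ^ n * H" by (rule mult_left_le_imp_le[OF _ V0])
      have "\<delta> * (real q ^ (?d - 1) * 4 ^ n) / (64 * 8 ^ ?d) \<le> \<delta> * (32 * s) / (64 * 8 ^ ?d)"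
        using Ms \<delta>0 by (intro divide_right_mono mult_left_mono) (auto simp: M)
      also have "\<dots> \<le> 8 * 4 ^ n * H" using 1 by simp
      finally have "4 ^ n * (\<delta> * real q ^ (?d - 1) / (512 * 8 ^ ?d)) \<le> 4 ^ n * H"
        by (simp add: field_simps)
      then have 2: "\<delta> * real q ^ (?d - 1) / (512 * 8 ^ ?d) \<le> H"
        by (rule mult_left_le_imp_le) simp
      have "\<delta> * real q ^ (?d - 1) = sqrt (1 / (2 * real q ^ (?d - 2)) * (real q ^ (?d - 1))\<^sup>2)"
        by (simp add: \<delta>_def real_sqrt_mult real_sqrt_divide)
      also have "1 / (2 * real q ^ (?d - 2)) * (real q ^ (?d - 1))\<^sup>2 = real q ^ ?d / 2"
      proof -
        have "(real q ^ (?d - 1))\<^sup>2 = real q ^ (?d - 2) * real q ^ ?d"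
        proof -
          have "(?d - 1) * 2 = (?d - 2) + ?d" using d by linarith
          then show ?thesis by (simp only: power_mult[symmetric] power_add[symmetric])
        qed
        then show ?thesis using q by simp
      qed
      finally have "\<delta> * real q ^ (?d - 1) = sqrt (real q ^ ?d) / sqrt 2" by (simp add: real_sqrt_divide)
      then show ?thesis using 2 by (simp add: c_def mult.commute)
    qed
    then show "\<exists>T\<subseteq>boxes q i0. card (boxes q i0) \<le> 2 * card T \<and>
      (\<forall>S \<gamma> H. S \<subseteq> T \<longrightarrow> (\<forall>R\<in>S. \<bar>\<gamma> R\<bar> = 1) \<longrightarrow> card T \<le> 16 * card S \<longrightarrow>
        (\<forall>x\<in>grid (?d * q + 1). \<bar>\<Sum>R\<in>S. \<gamma> R * box_zigzag (?d * q + 1) R x\<bar> \<le> H) \<longrightarrow>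
        c * sqrt (real q ^ ?d) \<le> H)"
      using T unfolding N_def by blast
  qed
qed

section \<open>Integrals and norms\<close>

text \<open>The derivative of \<^const>\<open>zigzag\<close>.\<close>

definition slope :: "real \<Rightarrow> real" where
  "slope t = indicator {0..} t - 4 * indicator {1/4..} t + 6 * indicator {1/2..} t
     - 4 * indicator {3/4..} t + indicator {1..} t"

lemma abs_slope_le: "\<bar>slope t\<bar> \<le> 3"
  by (auto simp: slope_def indicator_def)

lemma slope_outside: "t < 0 \<or> 1 \<le> t \<Longrightarrow> slope t = 0"
  by (auto simp: slope_def indicator_def)

lemma borel_measurable_slope [measurable]: "slope \<in> borel_measurable borel"
  unfolding slope_def[abs_def] by measurable

lemma integral_indicator_ray:
  fixes a x :: real
  assumes "0 \<le> a" "0 \<le> x"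
  shows "integrable lborel (\<lambda>t. indicator {0..x} t * indicator {a..} t :: real)"
    "(LINT t|lborel. indicator {0..x} t * indicator {a..} t) = max 0 (x - a)"
proof -
  have "(\<lambda>t. indicator {0..x} t * indicator {a..} t :: real) = indicator {a..x}"
    using assms by (auto simp: indicator_def fun_eq_iff)
  then show "integrable lborel (\<lambda>t. indicator {0..x} t * indicator {a..} t :: real)"
    "(LINT t|lborel. indicator {0..x} t * indicator {a..} t) = max 0 (x - a)"
    by (auto simp: max_def integrable_indicator_iff emeasure_lborel_Icc_eq)
qed

lemma integral_slope:
  assumes "0 \<le> x"
  shows "integrable lborel (\<lambda>t. indicator {0..x} t * slope (4 ^ r * t - real j))"
    "(LINT t|lborel. indicator {0..x} t * slope (4 ^ r * t - real j)) = zigzag (4 ^ r * x - real j) / 4 ^ r"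
proof -
  define a where "a = (\<lambda>b. (real j + b) / 4 ^ r :: real)"
  have a0: "0 \<le> b \<Longrightarrow> 0 \<le> a b" for b by (simp add: a_def)
  have ind: "indicator {b..} (4 ^ r * t - real j) = (indicator {a b..} t :: real)" for b t
    by (auto simp: a_def indicator_def field_simps)
  have eq: "(\<lambda>t. indicator {0..x} t * slope (4 ^ r * t - real j)) =
     (\<lambda>t. indicator {0..x} t * indicator {a 0..} t - 4 * (indicator {0..x} t * indicator {a (1/4)..} t)
       + 6 * (indicator {0..x} t * indicator {a (1/2)..} t) - 4 * (indicator {0..x} t * indicator {a (3/4)..} t)
       + indicator {0..x} t * indicator {a 1..} t)"
    unfolding slope_def ind by (simp add: algebra_simps)
  note int = integral_indicator_ray[OF a0 assms]
  have mx: "max 0 (x - a b) = max 0 (4 ^ r * x - real j - b) / 4 ^ r" for b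
    by (auto simp: a_def max_def field_simps)
  show "integrable lborel (\<lambda>t. indicator {0..x} t * slope (4 ^ r * t - real j))"
    unfolding eq by (intro Bochner_Integration.integrable_add Bochner_Integration.integrable_diff integrable_mult_right int(1)) auto
  have "(LINT t|lborel. indicator {0..x} t * slope (4 ^ r * t - real j))
    = max 0 (x - a 0) - 4 * max 0 (x - a (1/4)) + 6 * max 0 (x - a (1/2)) - 4 * max 0 (x - a (3/4)) + max 0 (x - a 1)"
    unfolding eq by (simp add: int Bochner_Integration.integral_add Bochner_Integration.integral_diff
        Bochner_Integration.integrable_add Bochner_Integration.integrable_diff)
  also have "\<dots> = zigzag (4 ^ r * x - real j) / 4 ^ r"
    unfolding mx zigzag_def by (simp add: add_divide_distrib diff_divide_distrib)
  finally show "(LINT t|lborel. indicator {0..x} t * slope (4 ^ r * t - real j)) = zigzag (4 ^ r * x - real j) / 4 ^ r" .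
qed

section \<open>Integrals of tensor products\<close>

lemma prod_Basis_vec:
  fixes f :: "'n::finite \<Rightarrow> real \<Rightarrow> real" and y :: "real ^ 'n"
  shows "(\<Prod>b\<in>Basis. f (axis_index b) (y \<bullet> b)) = (\<Prod>i\<in>UNIV. f i (y $ i))"
proof -
  have B: "(Basis :: (real ^ 'n) set) = (\<lambda>i. axis i 1) ` UNIV" by (auto simp: Basis_vec_def)
  have inj: "inj (\<lambda>i :: 'n. axis i (1::real))" by (auto simp: inj_on_def axis_eq_axis)
  show ?thesis
    unfolding B prod.reindex[OF inj] by (simp add: axis_index_axis cart_eq_inner_axis[of y])
qed

lemma lborel_integral_prod:
  fixes f :: "'n::finite \<Rightarrow> real \<Rightarrow> real"
  assumes "\<And>i. integrable lborel (f i)"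
  shows "(LINT y|lborel. (\<Prod>i\<in>UNIV. f i ((y :: real ^ 'n) $ i))) = (\<Prod>i\<in>UNIV. (LINT t|lborel. f i t))"
proof -
  interpret product_sigma_finite "\<lambda>_ :: real ^ 'n. lborel :: real measure"
    by standard
  have meas [measurable]: "f i \<in> borel_measurable borel" for i
    using borel_measurable_integrable[OF assms[of i]] by simp
  have "(LINT y|lborel. (\<Prod>i\<in>UNIV. f i ((y :: real ^ 'n) $ i)))
      = (LINT y|lborel. (\<Prod>b\<in>Basis. f (axis_index b) ((y :: real ^ 'n) \<bullet> b)))"
    by (simp add: prod_Basis_vec)
  also have "\<dots> = (LINT g|(\<Pi>\<^sub>M b\<in>Basis. lborel). (\<Prod>b\<in>Basis. f (axis_index b) ((\<Sum>b\<in>Basis. g b *\<^sub>R b) \<bullet> (b :: real ^ 'n))))"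
    by (subst lborel_eq, subst integral_distr) simp_all
  also have "\<dots> = (LINT g|(\<Pi>\<^sub>M b\<in>Basis. lborel). (\<Prod>b\<in>(Basis :: (real ^ 'n) set). f (axis_index b) (g b)))"
    by (intro Bochner_Integration.integral_cong refl prod.cong) simp
  also have "\<dots> = (\<Prod>b\<in>(Basis :: (real ^ 'n) set). (LINT t|lborel. f (axis_index b) t))"
    by (rule product_integral_prod) (use assms in auto)
  also have "\<dots> = (\<Prod>i\<in>UNIV. (LINT t|lborel. f i t))"
    using prod_Basis_vec[of "\<lambda>i _. LINT t|lborel. f i t" "0 :: real ^ 'n"] by simp
  finally show ?thesis .
qed

text \<open>The mixed derivative, of order one in every coordinate, of the tensor product of zigzags
  on the box, up to the constant volume factor: the function \<open>f_R\<close> of the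
  overview.\<close>

definition box_slope :: "'n::finite box \<Rightarrow> real ^ 'n \<Rightarrow> real" where
  "box_slope R y = (\<Prod>i\<in>UNIV. slope (4 ^ fst R i * y $ i - real (snd R i)))"

lemma borel_measurable_box_slope [measurable]: "box_slope R \<in> borel_measurable borel"
  unfolding box_slope_def[abs_def] by measurable

lemma abs_box_slope_le: "\<bar>box_slope (R :: 'n::finite box) y\<bar> \<le> 3 ^ CARD('n)"
proof -
  have "(\<Prod>i\<in>(UNIV :: 'n set). \<bar>slope (4 ^ fst R i * y $ i - real (snd R i))\<bar>) \<le> (\<Prod>i\<in>(UNIV :: 'n set). 3)"
    by (intro prod_mono) (simp add: abs_slope_le)
  then show ?thesis by (simp add: box_slope_def abs_prod)
qed

lemma integrable_lebesgue_on_bounded: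
  fixes f :: "real ^ 'n \<Rightarrow> real"
  assumes [measurable]: "f \<in> borel_measurable borel" and "\<And>y. \<bar>f y\<bar> \<le> B"
  shows "integrable (lebesgue_on (cbox a b)) f"
proof (rule finite_measure.integrable_const_bound[where B = B])
  show "finite_measure (lebesgue_on (cbox a b))"
    by (intro finite_measureI) (simp add: emeasure_restrict_space emeasure_lborel_cbox_eq)
  show "f \<in> borel_measurable (lebesgue_on (cbox a b))"
    by (intro measurable_restrict_space1 measurable_completion) simp
  show "AE x in lebesgue_on (cbox a b). norm (f x) \<le> B" using assms(2) by simp
qed

lemma Int_op_box_slope:
  fixes x :: "real ^ 'n::finite"
  assumes "x \<in> unit_cube"
  shows "Int_op (box_slope R) x = (\<Prod>i\<in>UNIV. zigzag (4 ^ fst R i * x $ i - real (snd R i)) / 4 ^ fst R i)"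
proof -
  have x0: "0 \<le> x $ i" for i using assms by (simp add: mem_box_cart)
  define g where "g = (\<lambda>i t. indicator {0..x $ i} t * slope (4 ^ fst R i * t - real (snd R i)))"
  have ind: "indicator (cbox 0 x) y *\<^sub>R box_slope R y = (\<Prod>i\<in>UNIV. g i (y $ i))" for y
  proof (cases "y \<in> cbox 0 x")
    case True
    then show ?thesis by (simp add: g_def box_slope_def mem_box_cart)
  next
    case False
    then obtain i where "y $ i \<notin> {0..x $ i}" by (auto simp: mem_box_cart)
    then have "g i (y $ i) = 0" by (simp add: g_def)
    then have "(\<Prod>i\<in>UNIV. g i (y $ i)) = 0" by (intro prod_zero) auto
    then show ?thesis using False by simp
  qed
  have "Int_op (box_slope R) x = (LINT y|lebesgue. indicator (cbox 0 x) y *\<^sub>R box_slope R y)"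
    unfolding Int_op_def by (rule integral_restrict_space) simp
  also have "\<dots> = (LINT y|lborel. indicator (cbox 0 x) y *\<^sub>R box_slope R y)"
    by (rule integral_completion) simp
  also have "\<dots> = (LINT y|lborel. (\<Prod>i\<in>UNIV. g i (y $ i)))" unfolding ind ..
  also have "\<dots> = (\<Prod>i\<in>UNIV. (LINT t|lborel. g i t))"
    unfolding g_def by (rule lborel_integral_prod) (rule integral_slope(1)[OF x0])
  also have "\<dots> = (\<Prod>i\<in>UNIV. zigzag (4 ^ fst R i * x $ i - real (snd R i)) / 4 ^ fst R i)"
    unfolding g_def integral_slope(2)[OF x0] ..
  finally show ?thesis .
qed

definition cell_midpoint :: "nat \<Rightarrow> ('n::finite \<Rightarrow> nat) \<Rightarrow> real ^ 'n" where
  "cell_midpoint N x = (\<chi> i. (real (x i) + 1/2) / 4 ^ N)"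

lemma midpoint_in_cube:
  assumes "x \<in> grid N"
  shows "cell_midpoint N x \<in> unit_cube"
proof -
  have "(real (x i) + 1/2) / 4 ^ N \<le> 1" for i
  proof -
    have "x i < 4 ^ N" using assms by (auto simp: grid_def)
    then have "x i + 1 \<le> 4 ^ N" by simp
    then have "real (x i + 1) \<le> real (4 ^ N)" by (simp only: of_nat_le_iff)
    then show ?thesis by simp
  qed
  then show ?thesis by (simp add: mem_box_cart cell_midpoint_def)
qed

text \<open>Integration costs \<open>4 ^ fst R i\<close> in each coordinate. Equal volumes make the
  total cost independent of \<open>R\<close>, so signed sums of slopes integrate to signed sums of
  zigzags with one common factor.\<close>

lemma Int_op_box_slope_midpoint:
  fixes x :: "'n::finite \<Rightarrow> nat"
  assumes "R \<in> boxes q i0" "x \<in> grid N" "N = CARD('n) * q + 1"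
  shows "Int_op (box_slope R) (cell_midpoint N x) = box_zigzag N R x / 4 ^ (CARD('n) * q)"
proof -
  have "Int_op (box_slope R) (cell_midpoint N x)
     = (\<Prod>i\<in>UNIV. zigzag (4 ^ fst R i * cell_midpoint N x $ i - real (snd R i)) / 4 ^ fst R i)"
    by (rule Int_op_box_slope[OF midpoint_in_cube[OF assms(2)]])
  also have "\<dots> = (\<Prod>i\<in>UNIV. zigzag_at N (fst R i) (snd R i) (x i) / 4 ^ fst R i)"
  proof (intro prod.cong refl)
    fix i
    have "fst R i \<le> N" using boxesD(3)[OF assms(1), of i] assms(3) by simp
    then have "(4::real) ^ N = 4 ^ fst R i * 4 ^ (N - fst R i)" by (simp add: power_add[symmetric])
    then have "4 ^ fst R i * cell_midpoint N x $ i = (real (x i) + 1/2) / 4 ^ (N - fst R i)"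
      by (simp add: cell_midpoint_def)
    then show "zigzag (4 ^ fst R i * cell_midpoint N x $ i - real (snd R i)) / 4 ^ fst R i
       = zigzag_at N (fst R i) (snd R i) (x i) / 4 ^ fst R i" by (simp add: zigzag_at_def)
  qed
  also have "\<dots> = box_zigzag N R x / 4 ^ (\<Sum>i\<in>UNIV. fst R i)"
    by (simp add: prod_dividef box_zigzag_def power_sum)
  finally show ?thesis using boxesD(4)[OF assms(1)] by simp
qed

text \<open>At a given point at most one box of each shape contributes: \<open>slope\<close> lives
  on a half-open interval, so the position is a floor. Hence the count of shapes, and
  \<open>9 ^ d\<close> is the square of the bound \<open>3 ^ d\<close>.\<close>

lemma sum_box_slope_squares_le:
  fixes y :: "real ^ 'n::finite"
  shows "(\<Sum>R\<in>boxes q i0. (box_slope R y)\<^sup>2) \<le> 9 ^ CARD('n) * real q ^ (CARD('n) - 1)"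
proof -
  define B where "B = {R\<in>boxes q i0. box_slope R y \<noteq> 0}"
  have finB: "finite B" by (rule finite_subset[OF _ finite_boxes[of q i0]]) (auto simp: B_def)
  have pos: "int (snd R i) = \<lfloor>4 ^ fst R i * y $ i\<rfloor>" if "R \<in> B" for R i
  proof -
    have "slope (4 ^ fst R i * y $ i - real (snd R i)) \<noteq> 0"
      using that by (auto simp: B_def box_slope_def)
    then have "\<not> (4 ^ fst R i * y $ i - real (snd R i) < 0 \<or> 1 \<le> 4 ^ fst R i * y $ i - real (snd R i))"
      using slope_outside by blast
    then show ?thesis by (intro floor_unique[symmetric]) auto
  qed
  have "inj_on fst B"
  proof (rule inj_onI)
    fix R R' assume R: "R \<in> B" "R' \<in> B" "fst R = fst R'"
    then have "snd R = snd R'" using pos[OF R(1)] pos[OF R(2)] by (intro ext) (metis of_nat_eq_iff)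
    then show "R = R'" using R by (simp add: prod_eq_iff)
  qed
  moreover have "fst ` B \<subseteq> shapes q i0" using boxesD(1) by (auto simp: B_def)
  ultimately have "card B \<le> card (shapes q i0)" using finite_shapes by (intro card_inj_on_le)
  then have cB: "real (card B) \<le> real q ^ (CARD('n) - 1)" unfolding card_shapes by (metis of_nat_le_iff of_nat_power)
  have "(\<Sum>R\<in>boxes q i0. (box_slope R y)\<^sup>2) = (\<Sum>R\<in>B. (box_slope R y)\<^sup>2)"
    unfolding B_def using finite_boxes by (intro sum.mono_neutral_right) auto
  also have "\<dots> \<le> (\<Sum>R\<in>B. 9 ^ CARD('n))"
  proof (rule sum_mono)
    fix R
    have "\<bar>box_slope R y\<bar>\<^sup>2 \<le> (3 ^ CARD('n))\<^sup>2" by (intro power_mono abs_box_slope_le) simp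
    then show "(box_slope R y)\<^sup>2 \<le> 9 ^ CARD('n)" by (simp add: power_mult[symmetric] mult.commute[of _ 2] power_mult)
  qed
  also have "\<dots> \<le> 9 ^ CARD('n) * real q ^ (CARD('n) - 1)" using cB by (simp add: mult.commute)
  finally show ?thesis .
qed

section \<open>Moments of random signed sums and \<open>L^p\<close> norms\<close>

lemma exp_plus_exp_minus_le: "exp z + exp (- z) \<le> 2 * exp (z\<^sup>2)" for z :: real
proof -
  have "exp z + exp (- z) \<le> 2 * exp (z\<^sup>2)" if "0 \<le> z" for z :: real
  proof (cases "z \<le> 1")
    case True
    have "exp z \<le> 1 + z + z\<^sup>2" using exp_bound[OF that True] .
    moreover have "exp (- z) \<le> 1 - z + z\<^sup>2"
    proof -
      have "exp (- z) \<le> 1 / (1 + z)"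
        using exp_ge_add_one_self[of z] that by (simp add: exp_minus field_simps)
      \<comment> \<open>Multiplied by \<open>1 + z\<close>, the right side becomes
        \<open>1 + z^3\<close>.\<close>
      also have "\<dots> \<le> 1 - z + z\<^sup>2"
        using that by (simp add: field_simps power2_eq_square)
      finally show ?thesis .
    qed
    moreover have "1 + z\<^sup>2 \<le> exp (z\<^sup>2)" by (rule exp_ge_add_one_self)
    ultimately show ?thesis by linarith
  next
    case False
    then have "z \<le> z\<^sup>2" by (simp add: power2_eq_square)
    then have "exp z \<le> exp (z\<^sup>2)" "exp (- z) \<le> exp (z\<^sup>2)" using that by auto
    then show ?thesis by linarith
  qed
  from this[of "\<bar>z\<bar>"] show ?thesis by (cases "0 \<le> z") (auto simp: add.commute)
qed

lemma abs_powr_le_exp: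
  assumes "0 \<le> p"
  obtains C :: real where "0 < C" "\<And>z :: real. \<bar>z\<bar> powr p \<le> C * (exp z + exp (- z))"
proof -
  define k where "k = nat \<lceil>p\<rceil>"
  define C :: real where "C = 1 + fact k"
  have "\<bar>z\<bar> powr p \<le> C * (exp z + exp (- z))" for z :: real
  proof -
    have "\<bar>z\<bar> powr p \<le> 1 + \<bar>z\<bar> ^ k"
    proof (cases "\<bar>z\<bar> \<le> 1")
      case True
      then have "\<bar>z\<bar> powr p \<le> 1" using assms by (intro powr_le1) auto
      then show ?thesis by (simp add: add_increasing2)
    next
      case False
      then have "\<bar>z\<bar> powr p \<le> \<bar>z\<bar> powr real k"
        using assms by (intro powr_mono) (auto simp: k_def)
      also have "\<dots> = \<bar>z\<bar> ^ k" using False by (intro powr_realpow) auto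
      finally show ?thesis by simp
    qed
    also have "\<dots> \<le> 1 * exp \<bar>z\<bar> + fact k * exp \<bar>z\<bar>"
      by (intro add_mono power_le_fact_exp) auto
    also have "\<dots> = C * exp \<bar>z\<bar>" by (simp add: C_def algebra_simps)
    also have "\<dots> \<le> C * (exp z + exp (- z))"
      by (intro mult_left_mono) (auto simp: C_def abs_if)
    finally show ?thesis .
  qed
  then show ?thesis using that[of C] by (simp add: C_def add_pos_pos)
qed

text \<open>A substitute for the upper Khintchine inequality, by exponential moments. It is not
  homogeneous in \<open>a\<close>, but its constant is independent of \<open>T\<close>, and it is
  applied to coefficients scaled to a bounded sum of squares.\<close>

lemma sum_signs_powr_le:
  assumes "0 \<le> p"
  obtains C :: real where "0 < C"
    "\<And>(T :: 'a set) a. finite T \<Longrightarrow>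
      (\<Sum>\<alpha>\<in>Pow T. \<bar>\<Sum>R\<in>T. sign_of \<alpha> R * a R\<bar> powr p) \<le> 2 ^ card T * (C * exp (\<Sum>R\<in>T. (a R)\<^sup>2))"
proof -
  obtain C where C: "0 < C" "\<And>z :: real. \<bar>z\<bar> powr p \<le> C * (exp z + exp (- z))"
    using abs_powr_le_exp[OF assms] by blast
  have ex: "(\<Sum>\<alpha>\<in>Pow T. exp (\<Sum>R\<in>T. sign_of \<alpha> R * a R)) \<le> 2 ^ card T * exp (\<Sum>R\<in>T. (a R)\<^sup>2)"
    if T: "finite T" for T :: "'a set" and a
  proof -
    have "(\<Sum>\<alpha>\<in>Pow T. exp (\<Sum>R\<in>T. sign_of \<alpha> R * a R)) = (\<Prod>R\<in>T. exp (a R) + exp (- a R))"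
      using sum_Pow_prod[OF T, of "\<lambda>R s. exp (s * a R)"] by (simp add: exp_sum T)
    also have "\<dots> \<le> (\<Prod>R\<in>T. 2 * exp ((a R)\<^sup>2))"
      by (intro prod_mono conjI exp_plus_exp_minus_le) (simp add: add_nonneg_nonneg)
    finally show ?thesis by (simp add: prod.distrib exp_sum T)
  qed
  show ?thesis
  proof (rule that[of "2 * C"])
    fix T :: "'a set" and a assume T: "finite T"
    have "(\<Sum>\<alpha>\<in>Pow T. \<bar>\<Sum>R\<in>T. sign_of \<alpha> R * a R\<bar> powr p)
       \<le> (\<Sum>\<alpha>\<in>Pow T. C * (exp (\<Sum>R\<in>T. sign_of \<alpha> R * a R) + exp (- (\<Sum>R\<in>T. sign_of \<alpha> R * a R))))"
      by (intro sum_mono C(2))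
    also have "\<dots> = C * ((\<Sum>\<alpha>\<in>Pow T. exp (\<Sum>R\<in>T. sign_of \<alpha> R * a R))
        + (\<Sum>\<alpha>\<in>Pow T. exp (\<Sum>R\<in>T. sign_of \<alpha> R * (- a R))))"
      by (simp add: sum_distrib_left sum.distrib distrib_left sum_negf)
    also have "\<dots> \<le> C * (2 ^ card T * exp (\<Sum>R\<in>T. (a R)\<^sup>2) + 2 ^ card T * exp (\<Sum>R\<in>T. (a R)\<^sup>2))"
      using ex[OF T, of a] ex[OF T, of "\<lambda>R. - a R"] C(1) by (intro mult_left_mono add_mono) auto
    finally show "(\<Sum>\<alpha>\<in>Pow T. \<bar>\<Sum>R\<in>T. sign_of \<alpha> R * a R\<bar> powr p) \<le> 2 ^ card T * (2 * C * exp (\<Sum>R\<in>T. (a R)\<^sup>2))"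
      by (simp add: algebra_simps)
  qed (use C in simp)
qed

definition signed_slopes :: "'n::finite box set \<Rightarrow> 'n box set \<Rightarrow> real ^ 'n \<Rightarrow> real" where
  "signed_slopes T \<alpha> y = (\<Sum>R\<in>T. sign_of \<alpha> R * box_slope R y)"

lemma borel_measurable_signed_slopes [measurable]: "signed_slopes T \<alpha> \<in> borel_measurable borel"
  unfolding signed_slopes_def[abs_def] by measurable

lemma abs_signed_slopes_le: "\<bar>signed_slopes T \<alpha> (y :: real ^ 'n::finite)\<bar> \<le> real (card T) * 3 ^ CARD('n)"
proof -
  have "\<bar>signed_slopes T \<alpha> y\<bar> \<le> (\<Sum>R\<in>T. \<bar>sign_of \<alpha> R * box_slope R y\<bar>)"
    unfolding signed_slopes_def by (rule sum_abs)
  also have "\<dots> \<le> (\<Sum>R\<in>T. 3 ^ CARD('n))"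
    by (intro sum_mono) (simp add: abs_mult sign_of_def abs_box_slope_le)
  finally show ?thesis by simp
qed

text \<open>After division by the square root of the number of shapes the sum of squares is bounded
  at every point. So is the average over the signs of the \<open>p\<close>-th power, and with it
  that of the integral; Markov's inequality with factor 2 keeps at least half of the
  patterns.\<close>

lemma most_signed_slopes_in_Lp_ball:
  assumes p: "1 \<le> p"
  obtains B where "0 < B"
    "\<And>q (i0 :: 'n::finite) T. 1 \<le> q \<Longrightarrow> T \<subseteq> boxes q i0 \<Longrightarrow>
      2 ^ card T \<le> 2 * card {\<alpha>\<in>Pow T. (\<lambda>y. signed_slopes T \<alpha> y / (B * sqrt (real q ^ (CARD('n) - 1))))
                                   \<in> {f \<in> Lp_space p. Lp_norm p f \<le> 1}}"
proof -
  let ?d = "CARD('n)" and ?M = "lebesgue_on (unit_cube :: (real ^ 'n) set)"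
  obtain C where C: "0 < C" and sums: "\<And>(T :: 'n box set) a. finite T \<Longrightarrow>
      (\<Sum>\<alpha>\<in>Pow T. \<bar>\<Sum>R\<in>T. sign_of \<alpha> R * a R\<bar> powr p) \<le> 2 ^ card T * (C * exp (\<Sum>R\<in>T. (a R)\<^sup>2))"
  proof -
    have "0 \<le> p" using p by simp
    then show thesis using sum_signs_powr_le[of p thesis] that by blast
  qed
  define K where "K = C * exp (9 ^ ?d)"
  have K: "0 < K" using C by (simp add: K_def)
  \<comment> \<open>Chosen with \<open>B powr p = 2 * K\<close>, so that an integral up to twice the
    average \<open>K\<close> becomes norm at most 1.\<close>
  define B where "B = (2 * K) powr (1 / p)"
  have B: "0 < B" "B powr p = 2 * K" using K p by (auto simp: B_def powr_powr)
  show ?thesis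
  proof (rule that[OF B(1)])
    fix q and i0 :: 'n and T assume q: "1 \<le> q" and T: "T \<subseteq> boxes q i0"
    define m where "m = sqrt (real q ^ (?d - 1))"
    have m: "0 < m" "m\<^sup>2 = real q ^ (?d - 1)" using q by (auto simp: m_def)
    have finT: "finite T" using T finite_boxes finite_subset by blast
    define I where "I = (\<lambda>\<alpha>. LINT y|?M. \<bar>signed_slopes T \<alpha> y / m\<bar> powr p)"
    have int: "integrable ?M (\<lambda>y. \<bar>signed_slopes T \<alpha> y / r\<bar> powr p)" if "0 < r" for \<alpha> r
    proof (rule integrable_lebesgue_on_bounded)
      show "(\<lambda>y. \<bar>signed_slopes T \<alpha> y / r\<bar> powr p) \<in> borel_measurable borel" by measurable
      show "\<bar>\<bar>signed_slopes T \<alpha> y / r\<bar> powr p\<bar> \<le> (real (card T) * 3 ^ ?d / r) powr p" for y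
        using abs_signed_slopes_le[of T \<alpha> y] p that by (simp add: abs_divide) (intro powr_mono2 divide_right_mono; simp)
    qed
    have cube: "measure ?M (space ?M) = 1"
    proof -
      have "(unit_cube :: (real ^ 'n) set) \<noteq> {}" by (simp add: interval_ne_empty_cart)
      then show ?thesis by (simp add: measure_restrict_space content_cbox_cart)
    qed
    have "sum I (Pow T) = (LINT y|?M. (\<Sum>\<alpha>\<in>Pow T. \<bar>signed_slopes T \<alpha> y / m\<bar> powr p))"
      unfolding I_def by (subst Bochner_Integration.integral_sum) (use int m in auto)
    also have "\<dots> \<le> (LINT y|?M. 2 ^ card T * K)"
    proof (rule integral_mono)
      show "integrable ?M (\<lambda>y. \<Sum>\<alpha>\<in>Pow T. \<bar>signed_slopes T \<alpha> y / m\<bar> powr p)"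
        using int m by (intro Bochner_Integration.integrable_sum) auto
      show "integrable ?M (\<lambda>y. 2 ^ card T * K)" by (rule integrable_lebesgue_on_bounded) auto
      fix y :: "real ^ 'n"
      have "(\<Sum>R\<in>T. (box_slope R y / m)\<^sup>2) \<le> (\<Sum>R\<in>boxes q i0. (box_slope R y / m)\<^sup>2)"
        using T finite_boxes by (intro sum_mono2) auto
      also have "\<dots> = (\<Sum>R\<in>boxes q i0. (box_slope R y)\<^sup>2) / m\<^sup>2"
        by (simp add: power_divide sum_divide_distrib)
      also have "\<dots> \<le> 9 ^ ?d * m\<^sup>2 / m\<^sup>2"
        unfolding m(2) by (intro divide_right_mono sum_box_slope_squares_le) auto
      also have "\<dots> = 9 ^ ?d" using m(1) by simp
      finally have sq: "(\<Sum>R\<in>T. (box_slope R y / m)\<^sup>2) \<le> 9 ^ ?d" .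
      have "(\<Sum>\<alpha>\<in>Pow T. \<bar>signed_slopes T \<alpha> y / m\<bar> powr p)
          = (\<Sum>\<alpha>\<in>Pow T. \<bar>\<Sum>R\<in>T. sign_of \<alpha> R * (box_slope R y / m)\<bar> powr p)"
        by (simp add: signed_slopes_def sum_divide_distrib)
      also have "\<dots> \<le> 2 ^ card T * (C * exp (\<Sum>R\<in>T. (box_slope R y / m)\<^sup>2))" by (rule sums[OF finT])
      also have "\<dots> \<le> 2 ^ card T * K"
        unfolding K_def using sq C by (intro mult_left_mono) auto
      finally show "(\<Sum>\<alpha>\<in>Pow T. \<bar>signed_slopes T \<alpha> y / m\<bar> powr p) \<le> 2 ^ card T * K" .
    qed
    also have "\<dots> = real (card (Pow T)) * K" using cube finT by (simp add: card_Pow)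
    finally have sumI: "sum I (Pow T) \<le> real (card (Pow T)) * K" .
    let ?bad = "{\<alpha>\<in>Pow T. 2 * K < I \<alpha>}"
    let ?good = "{\<alpha>\<in>Pow T. (\<lambda>y. signed_slopes T \<alpha> y / (B * m)) \<in> {f \<in> Lp_space p. Lp_norm p f \<le> 1}}"
    have "2 * real (card ?bad) \<le> real (card (Pow T))"
      by (rule markov_count[OF _ _ sumI K]) (use finT in \<open>auto simp: I_def\<close>)
    moreover have "card (Pow T) \<le> card ?good + card ?bad"
    proof -
      have "Pow T \<subseteq> ?good \<union> ?bad"
      proof
        fix \<alpha> assume \<alpha>: "\<alpha> \<in> Pow T"
        show "\<alpha> \<in> ?good \<union> ?bad"
        proof (cases "2 * K < I \<alpha>")
          case False
          define f where "f = (\<lambda>y. signed_slopes T \<alpha> y / (B * m))"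
          have f: "\<bar>f y\<bar> powr p = \<bar>signed_slopes T \<alpha> y / m\<bar> powr p / (2 * K)" for y
          proof -
            have "\<bar>f y\<bar> = \<bar>signed_slopes T \<alpha> y / m\<bar> / B" using B m by (simp add: f_def abs_mult)
            then have "\<bar>f y\<bar> powr p = \<bar>signed_slopes T \<alpha> y / m\<bar> powr p / B powr p"
              using B(1) powr_divide[of "\<bar>signed_slopes T \<alpha> y / m\<bar>" B p] by (simp only: abs_ge_zero less_imp_le)
            then show ?thesis by (simp only: B(2))
          qed
          have "f \<in> borel_measurable borel" unfolding f_def by measurable
          then have "f \<in> borel_measurable ?M" by (intro measurable_restrict_space1 measurable_completion) simp
          moreover have "integrable ?M (\<lambda>y. \<bar>f y\<bar> powr p)" unfolding f using int m by simp
          moreover have "Lp_norm p f \<le> 1"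
          proof -
            have "(LINT y|?M. \<bar>f y\<bar> powr p) = I \<alpha> / (2 * K)" unfolding f I_def by simp
            also have "\<dots> \<le> 1" using False K by simp
            finally have "(LINT y|?M. \<bar>f y\<bar> powr p) powr (1 / p) \<le> 1"
              using p by (intro powr_le1) auto
            then show ?thesis by (simp add: Lp_norm_def)
          qed
          ultimately show ?thesis using \<alpha> by (auto simp: Lp_space_def f_def)
        qed (use \<alpha> in auto)
      qed
      then have "card (Pow T) \<le> card (?good \<union> ?bad)" using finT by (intro card_mono) auto
      then show ?thesis using card_Un_le le_trans by blast
    qed
    ultimately have "card (Pow T) \<le> 2 * card ?good" by linarith
    then show "2 ^ card T \<le> 2 * card {\<alpha>\<in>Pow T. (\<lambda>y. signed_slopes T \<alpha> y / (B * sqrt (real q ^ (?d - 1))))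
                                   \<in> {f \<in> Lp_space p. Lp_norm p f \<le> 1}}"
      using finT by (simp add: card_Pow m_def)
  qed
qed

lemma Int_op_signed_slopes:
  fixes x :: "'n::finite \<Rightarrow> nat"
  assumes "T \<subseteq> boxes q i0" "x \<in> grid N" "N = CARD('n) * q + 1"
  shows "Int_op (\<lambda>y. signed_slopes T \<alpha> y / r) (cell_midpoint N x)
       = (\<Sum>R\<in>T. sign_of \<alpha> R * box_zigzag N R x) / (r * 4 ^ (CARD('n) * q))"
proof -
  let ?M = "lebesgue_on (cbox 0 (cell_midpoint N x))"
  have int: "integrable ?M (box_slope R)" for R
    by (rule integrable_lebesgue_on_bounded[OF borel_measurable_box_slope abs_box_slope_le])
  have "Int_op (\<lambda>y. signed_slopes T \<alpha> y / r) (cell_midpoint N x) = (\<Sum>R\<in>T. sign_of \<alpha> R * Int_op (box_slope R) (cell_midpoint N x)) / r"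
    unfolding Int_op_def signed_slopes_def using int by (simp add: Bochner_Integration.integral_sum)
  also have "\<dots> = (\<Sum>R\<in>T. sign_of \<alpha> R * (box_zigzag N R x / 4 ^ (CARD('n) * q))) / r"
  proof -
    have "Int_op (box_slope R) (cell_midpoint N x) = box_zigzag N R x / 4 ^ (CARD('n) * q)" if "R \<in> T" for R
      using Int_op_box_slope_midpoint[of R q i0 x N] assms that by blast
    then show ?thesis by simp
  qed
  finally show ?thesis by (simp add: sum_divide_distrib mult.commute)
qed

text \<open>The supremum in \<open>sup_norm\<close> dominates the values once they are bounded
  above, which continuity on the compact cube provides.\<close>

lemma abs_le_one_of_B_inf:
  fixes b :: "real ^ 'n \<Rightarrow> real"
  assumes "b \<in> B_inf" "t \<in> unit_cube"
  shows "\<bar>b t\<bar> \<le> 1"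
proof -
  have "continuous_on unit_cube b" and s: "sup_norm b \<le> 1" using assms(1) by (auto simp: B_inf_def C_cube_def)
  then have "continuous_on unit_cube (\<lambda>t. \<bar>b t\<bar>)" by (intro continuous_intros)
  then have "bdd_above ((\<lambda>t. \<bar>b t\<bar>) ` unit_cube)"
    by (intro bounded_imp_bdd_above compact_imp_bounded compact_continuous_image compact_cbox)
  then have "\<bar>b t\<bar> \<le> sup_norm b" unfolding sup_norm_def by (rule cSUP_upper[OF assms(2)])
  then show ?thesis using s by simp
qed

text \<open>A Chernoff bound: each counted set has weight \<open>exp (- 2) ^ card S\<close> at least
  \<open>exp (- card T / 8)\<close>, and all weights together sum to
  \<open>(1 + exp (- 2)) ^ card T\<close>. The exponent 1/5 + 1/8 is below 1/3, hence well below
  \<open>ln 2\<close>.\<close>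

lemma card_small_subsets_le:
  assumes "finite T"
  shows "real (card {S\<in>Pow T. 16 * card S < card T}) \<le> exp (real (card T) / 3)"
proof -
  let ?t = "real (card T)" and ?A = "{S\<in>Pow T. 16 * card S < card T}"
  have e2: "exp (- 2 :: real) \<le> 1 / 5"
  proof -
    have "(5::real) \<le> exp 2" using exp_lower_Taylor_quadratic[of "2 :: real"] by simp
    then show ?thesis by (simp add: exp_minus field_simps)
  qed
  have "real (card ?A) * exp (- ?t / 8) = (\<Sum>S\<in>?A. exp (- ?t / 8))" by simp
  also have "\<dots> \<le> (\<Sum>S\<in>?A. exp (- 2) ^ card S)"
  proof (rule sum_mono)
    fix S assume "S \<in> ?A"
    then have "16 * real (card S) \<le> ?t" by simp
    then have "exp (- ?t / 8) \<le> exp (real (card S) * (- 2))" by simp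
    then show "exp (- ?t / 8) \<le> exp (- 2) ^ card S" by (simp only: exp_of_nat_mult)
  qed
  also have "\<dots> \<le> (\<Sum>S\<in>Pow T. exp (- 2) ^ card S)" using assms by (intro sum_mono2) auto
  also have "\<dots> = (\<Sum>S\<in>Pow T. \<Prod>R\<in>T. if sign_of S R = 1 then exp (- 2) else 1)"
  proof (intro sum.cong refl)
    fix S assume "S \<in> Pow T"
    then have "{R\<in>T. sign_of S R = 1} = S" by (auto simp: sign_of_def split: if_splits)
    then show "exp (- 2 :: real) ^ card S = (\<Prod>R\<in>T. if sign_of S R = 1 then exp (- 2) else 1)"
      using assms by (simp add: prod.If_cases Int_def)
  qed
  also have "\<dots> = (\<Prod>R\<in>T. exp (- 2) + 1)"
    using sum_Pow_prod[OF assms, of "\<lambda>R s. if s = 1 then exp (- 2) else 1"] by simp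
  also have "\<dots> = (1 + exp (- 2)) ^ card T" by (simp add: add.commute)
  also have "\<dots> \<le> exp (1 / 5) ^ card T"
    using e2 exp_ge_add_one_self[of "1 / 5 :: real"] by (intro power_mono) (linarith, simp add: add_nonneg_nonneg)
  also have "\<dots> = exp (?t / 5)" by (simp add: exp_of_nat_mult[symmetric])
  finally have "real (card ?A) * exp (- ?t / 8) * exp (?t / 8) \<le> exp (?t / 5) * exp (?t / 8)"
    by (rule mult_right_mono) simp
  also have "exp (?t / 5) * exp (?t / 8) = exp (?t / 5 + ?t / 8)" by (simp only: exp_add)
  also have "\<dots> \<le> exp (?t / 3)" by simp
  also have "real (card ?A) * exp (- ?t / 8) * exp (?t / 8) = real (card ?A)"
    by (simp add: mult.assoc exp_add[symmetric])
  finally show ?thesis .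
qed

section \<open>Entropy\<close>

text \<open>Two patterns whose integrals lie in the same \<epsilon>-ball differ on less than a
  sixteenth of \<open>T\<close>, since otherwise \<open>small\<close> separates them by more than
  \<open>2 * \<epsilon>\<close> at a grid point. Each ball thus captures at most
  \<open>exp (card T / 3)\<close> of at least \<open>2 ^ card T / 2\<close> admissible patterns, and
  \<open>ln 2 - 1/3\<close> exceeds 1/4.\<close>

lemma ln_cover_size_ge:
  fixes i0 :: "'n::finite"
  assumes T: "T \<subseteq> boxes q i0" and q: "1 \<le> q" and "0 < B" "0 < \<epsilon>" and big: "12 \<le> card T"
    and good: "2 ^ card T \<le> 2 * card {\<alpha>\<in>Pow T. (\<lambda>y. signed_slopes T \<alpha> y / (B * sqrt (real q ^ (CARD('n) - 1))))
                                   \<in> {f \<in> Lp_space p. Lp_norm p f \<le> 1}}"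
    and small: "\<And>S \<gamma>. S \<subseteq> T \<Longrightarrow> (\<forall>R\<in>S. \<bar>\<gamma> R\<bar> = 1) \<Longrightarrow> card T \<le> 16 * card S \<Longrightarrow>
        \<exists>x\<in>grid (CARD('n) * q + 1). \<epsilon> * B * sqrt (real q ^ (CARD('n) - 1)) * 4 ^ (CARD('n) * q)
           < \<bar>\<Sum>R\<in>S. \<gamma> R * box_zigzag (CARD('n) * q + 1) R x\<bar>"
    and cover: "(Ball_MW p :: (real ^ 'n \<Rightarrow> real) set) \<subseteq> (\<Union>m\<in>{1..k :: nat}. (\<lambda>b t. c m t + \<epsilon> * b t) ` B_inf)"
  shows "0 < k" "real (card T) / 4 \<le> ln (real k)"
proof -
  define N where "N = CARD('n) * q + 1"
  define r where "r = B * sqrt (real q ^ (CARD('n) - 1))"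
  have r: "0 < r" using q \<open>0 < B\<close> by (simp add: r_def)
  define F where "F = (\<lambda>\<alpha>. Int_op (\<lambda>y. signed_slopes T \<alpha> y / r))"
  define A where "A = {\<alpha>\<in>Pow T. (\<lambda>y. signed_slopes T \<alpha> y / r) \<in> {f \<in> Lp_space p. Lp_norm p f \<le> 1}}"
  have finT: "finite T" using T finite_boxes finite_subset by blast
  have finA: "finite A" using finT by (simp add: A_def)
  let ?W = "{S\<in>Pow T. 16 * card S < card T}"
  have finW: "finite ?W" using finT by simp
  define fib where "fib = (\<lambda>m. {\<alpha>\<in>A. F \<alpha> \<in> (\<lambda>b t. c m t + \<epsilon> * b t) ` B_inf})"
  have A_sub: "A \<subseteq> (\<Union>m\<in>{1..k}. fib m)"
  proof
    fix \<alpha> assume "\<alpha> \<in> A"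
    then have "F \<alpha> \<in> Ball_MW p" unfolding F_def Ball_MW_def A_def by blast
    then show "\<alpha> \<in> (\<Union>m\<in>{1..k}. fib m)" using cover \<open>\<alpha> \<in> A\<close> unfolding fib_def by blast
  qed
  have close: "16 * card ((\<alpha> - \<alpha>') \<union> (\<alpha>' - \<alpha>)) < card T" if fib: "\<alpha> \<in> fib m" "\<alpha>' \<in> fib m" for \<alpha> \<alpha>' m
  proof (rule ccontr)
    define S where "S = (\<alpha> - \<alpha>') \<union> (\<alpha>' - \<alpha>)"
    assume "\<not> 16 * card ((\<alpha> - \<alpha>') \<union> (\<alpha>' - \<alpha>)) < card T"
    then have "card T \<le> 16 * card S" by (simp add: S_def)
    moreover have ST: "S \<subseteq> T" using fib by (auto simp: S_def fib_def A_def)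
    moreover have "\<forall>R\<in>S. \<bar>sign_of \<alpha> R\<bar> = 1" by (simp add: sign_of_def)
    ultimately obtain x where x: "x \<in> grid N" and
      lt: "\<epsilon> * r * 4 ^ (CARD('n) * q) < \<bar>\<Sum>R\<in>S. sign_of \<alpha> R * box_zigzag N R x\<bar>"
      using small[of S "sign_of \<alpha>"] unfolding N_def[symmetric] r_def mult.assoc by blast
    obtain b b' where b: "b \<in> B_inf" "F \<alpha> = (\<lambda>t. c m t + \<epsilon> * b t)" and b': "b' \<in> B_inf" "F \<alpha>' = (\<lambda>t. c m t + \<epsilon> * b' t)"
      using fib unfolding fib_def by blast
    let ?t = "cell_midpoint N x"
    have t: "?t \<in> unit_cube" by (rule midpoint_in_cube[OF x])
    have "\<bar>b ?t - b' ?t\<bar> \<le> 2"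
      using abs_le_one_of_B_inf[OF b(1) t] abs_le_one_of_B_inf[OF b'(1) t] by linarith
    then have "\<epsilon> * \<bar>b ?t - b' ?t\<bar> \<le> \<epsilon> * 2" using \<open>0 < \<epsilon>\<close> by (intro mult_left_mono) auto
    moreover have "F \<alpha> ?t - F \<alpha>' ?t = \<epsilon> * (b ?t - b' ?t)" using b b' by (simp add: algebra_simps)
    ultimately have up: "\<bar>F \<alpha> ?t - F \<alpha>' ?t\<bar> \<le> 2 * \<epsilon>" using \<open>0 < \<epsilon>\<close> by (simp add: abs_mult mult.commute)
    \<comment> \<open>The sign differences vanish off the symmetric difference and are plus or minus
      2 on it. This 2 matches the diameter \<open>2 * \<epsilon>\<close> of a ball.\<close>
    have "F \<alpha> ?t - F \<alpha>' ?t = (\<Sum>R\<in>T. (sign_of \<alpha> R - sign_of \<alpha>' R) * box_zigzag N R x) / (r * 4 ^ (CARD('n) * q))"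
      unfolding F_def Int_op_signed_slopes[OF T x N_def]
      by (simp add: diff_divide_distrib[symmetric] sum_subtractf[symmetric] algebra_simps)
    also have "(\<Sum>R\<in>T. (sign_of \<alpha> R - sign_of \<alpha>' R) * box_zigzag N R x) = (\<Sum>R\<in>S. 2 * (sign_of \<alpha> R * box_zigzag N R x))"
      using ST finT by (intro sum.mono_neutral_cong_right) (auto simp: S_def sign_of_def)
    also have "\<dots> = 2 * (\<Sum>R\<in>S. sign_of \<alpha> R * box_zigzag N R x)" by (simp add: sum_distrib_left)
    finally have "\<bar>F \<alpha> ?t - F \<alpha>' ?t\<bar> = 2 * (\<bar>\<Sum>R\<in>S. sign_of \<alpha> R * box_zigzag N R x\<bar> / (r * 4 ^ (CARD('n) * q)))"
      using r by (simp add: abs_mult)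
    moreover have "\<epsilon> < \<bar>\<Sum>R\<in>S. sign_of \<alpha> R * box_zigzag N R x\<bar> / (r * 4 ^ (CARD('n) * q))"
      using lt r by (simp add: pos_less_divide_eq mult.assoc)
    ultimately show False using up by linarith
  qed
  have fib_le: "card (fib m) \<le> card ?W" for m
  proof (cases "fib m = {}")
    case False
    then obtain \<alpha>0 where \<alpha>0: "\<alpha>0 \<in> fib m" by blast
    show ?thesis
    \<comment> \<open>Symmetric difference with a fixed member is injective and carries the whole
      fibre into the small subsets.\<close>
    proof (rule card_inj_on_le[where f = "\<lambda>\<alpha>. (\<alpha> - \<alpha>0) \<union> (\<alpha>0 - \<alpha>)"])
      show "inj_on (\<lambda>\<alpha>. (\<alpha> - \<alpha>0) \<union> (\<alpha>0 - \<alpha>)) (fib m)" by (rule inj_onI) blast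
      show "(\<lambda>\<alpha>. (\<alpha> - \<alpha>0) \<union> (\<alpha>0 - \<alpha>)) ` fib m \<subseteq> ?W"
      proof (rule image_subsetI)
        fix \<alpha> assume \<alpha>: "\<alpha> \<in> fib m"
        then have "\<alpha> \<subseteq> T" "\<alpha>0 \<subseteq> T" using \<alpha>0 by (auto simp: fib_def A_def)
        then show "(\<alpha> - \<alpha>0) \<union> (\<alpha>0 - \<alpha>) \<in> ?W" using close[OF \<alpha> \<alpha>0] by auto
      qed
    qed (rule finW)
  qed simp
  have "card A \<le> card (\<Union>m\<in>{1..k}. fib m)"
    using A_sub finA by (intro card_mono) (auto simp: fib_def)
  also have "\<dots> \<le> (\<Sum>m\<in>{1..k}. card (fib m))" by (rule card_UN_le) simp
  also have "\<dots> \<le> (\<Sum>m\<in>{1..k}. card ?W)" by (intro sum_mono fib_le)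
  finally have "card A \<le> k * card ?W" by simp
  then have "real (card A) \<le> real k * real (card ?W)" by (simp only: of_nat_le_iff of_nat_mult[symmetric])
  also have "\<dots> \<le> real k * exp (real (card T) / 3)"
    using card_small_subsets_le[OF finT] by (intro mult_left_mono) auto
  finally have cA: "real (card A) \<le> real k * exp (real (card T) / 3)" .
  have "(2::nat) ^ card T \<le> 2 * card A" using good by (simp add: A_def r_def)
  then have "real (2 ^ card T) \<le> real (2 * card A)" by (simp only: of_nat_le_iff)
  then have main: "2 ^ card T \<le> 2 * (real k * exp (real (card T) / 3))" using cA by simp
  show k: "0 < k"
  proof (rule ccontr)
    assume "\<not> 0 < k"
    then have "(2::real) ^ card T \<le> 0" using main by simp
    moreover have "(0::real) < 2 ^ card T" by simp
    ultimately show False by linarith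
  qed
  have "ln ((2::real) ^ card T) \<le> ln (2 * (real k * exp (real (card T) / 3)))"
    using main k by (intro ln_mono) auto
  then have "real (card T) * ln 2 \<le> ln 2 + (ln (real k) + real (card T) / 3)"
    using k by (simp add: ln_realpow ln_mult)
  \<comment> \<open>\<open>ln 2\<close> occurs on both sides of the previous inequality, so its
    lower bound is applied to the combined coefficient \<open>card T - 1\<close>.\<close>
  moreover have "real (card T) * (2 / 3) - 2 / 3 \<le> real (card T) * ln 2 - ln 2"
  proof -
    have "(real (card T) - 1) * (2 / 3) \<le> (real (card T) - 1) * ln 2"
    using big ln2_ge_two_thirds by (intro mult_left_mono) auto
    then show ?thesis by (simp only: left_diff_distrib mult_1_left)
  qed
  moreover have "12 \<le> real (card T)" using big by simp
  ultimately show "real (card T) / 4 \<le> ln (real k)" by linarith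
qed

text \<open>An infimum of extended naturals is attained unless the set is empty, in which case the
  covering number is infinite. A bound for every finite cover therefore passes to the infimum;
  \<open>0 < k\<close> keeps \<open>ln_enat\<close> off its value at zero.\<close>

lemma covering_number_ge:
  assumes "\<And>k c. (Ball_MW p :: (real ^ 'n::finite \<Rightarrow> real) set) \<subseteq> (\<Union>m\<in>{1..k :: nat}. (\<lambda>b t. c m t + \<epsilon> * b t) ` B_inf)
      \<Longrightarrow> 0 < k \<and> L \<le> ln (real k)"
  shows "ereal L \<le> ln_enat (covering_number \<epsilon> p TYPE('n))"
proof -
  define Q where "Q = {enat k | k. \<exists>x :: nat \<Rightarrow> real ^ 'n \<Rightarrow> real.
            (\<forall>m\<in>{1..k}. x m \<in> C_cube) \<and>
            Ball_MW p \<subseteq> (\<Union>m\<in>{1..k}. (\<lambda>b t. x m t + \<epsilon> * b t) ` B_inf)}"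
  have cn: "covering_number \<epsilon> p TYPE('n) = Inf Q" unfolding covering_number_def Q_def ..
  show ?thesis
  proof (cases "Q = {}")
    case True
    then show ?thesis unfolding cn by (simp add: ln_enat_def Inf_enat_def)
  next
    case False
    then have "Inf Q \<in> Q" unfolding Inf_enat_def by (auto intro: LeastI)
    then obtain k where "Inf Q = enat k" "\<exists>x :: nat \<Rightarrow> real ^ 'n \<Rightarrow> real.
        Ball_MW p \<subseteq> (\<Union>m\<in>{1..k}. (\<lambda>b t. x m t + \<epsilon> * b t) ` B_inf)"
      unfolding Q_def by blast
    then show ?thesis using assms unfolding cn by (auto simp: ln_enat_def)
  qed
qed

text \<open>The sup norm \<open>q ^ (d/2)\<close> exceeds the normalisation
  \<open>q ^ ((d-1)/2)\<close> of the functions by \<open>sqrt q\<close>, which is the factor in the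
  admissible \<epsilon>. The 8 is 2 for \<open>T\<close> against all boxes, times 4 from the entropy
  count.\<close>

lemma covering_number_at_scale:
  assumes p: "1 \<le> p" and d: "3 \<le> CARD('n::finite)"
  obtains a q0 where "0 < a" "1 \<le> q0"
    "\<And>q \<epsilon>. q0 \<le> q \<Longrightarrow> 0 < \<epsilon> \<Longrightarrow> \<epsilon> < a * sqrt (real q) / 4 ^ (CARD('n) * q) \<Longrightarrow>
       ereal (real q ^ (CARD('n) - 1) * 4 ^ (CARD('n) * q) / 8) \<le> ln_enat (covering_number \<epsilon> p TYPE('n))"
proof -
  let ?d = "CARD('n)"
  obtain c q0 where c: "0 < c" "1 \<le> q0" and sb: "\<And>q (i0 :: 'n). q0 \<le> q \<Longrightarrow> \<exists>T\<subseteq>boxes q i0. card (boxes q i0) \<le> 2 * card T \<and>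
      (\<forall>S \<gamma> H. S \<subseteq> T \<longrightarrow> (\<forall>R\<in>S. \<bar>\<gamma> R\<bar> = 1) \<longrightarrow> card T \<le> 16 * card S \<longrightarrow>
        (\<forall>x\<in>grid (?d * q + 1). \<bar>\<Sum>R\<in>S. \<gamma> R * box_zigzag (?d * q + 1) R x\<bar> \<le> H) \<longrightarrow>
        c * sqrt (real q ^ ?d) \<le> H)"
    using box_zigzag_small_ball[OF d] by blast
  obtain B where B: "0 < B" and good: "\<And>q (i0 :: 'n) T. 1 \<le> q \<Longrightarrow> T \<subseteq> boxes q i0 \<Longrightarrow>
      2 ^ card T \<le> 2 * card {\<alpha>\<in>Pow T. (\<lambda>y. signed_slopes T \<alpha> y / (B * sqrt (real q ^ (?d - 1))))
                                   \<in> {f \<in> Lp_space p. Lp_norm p f \<le> 1}}"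
    using most_signed_slopes_in_Lp_ball[OF p] by blast
  show ?thesis
  proof (rule that[of "c / B" q0])
    show "0 < c / B" using B c by simp
    show "1 \<le> q0" by (rule c(2))
    fix q :: nat and \<epsilon> :: real
    assume q: "q0 \<le> q" and \<epsilon>: "0 < \<epsilon>" "\<epsilon> < c / B * sqrt (real q) / 4 ^ (?d * q)"
    have q1: "1 \<le> q" using q c by linarith
    \<comment> \<open>Any coordinate may play the distinguished role.\<close>
    obtain i0 :: 'n where True by blast
    obtain T where T: "T \<subseteq> boxes q i0" "card (boxes q i0) \<le> 2 * card T"
      and sbT: "\<And>S \<gamma> H. S \<subseteq> T \<Longrightarrow> (\<forall>R\<in>S. \<bar>\<gamma> R\<bar> = 1) \<Longrightarrow> card T \<le> 16 * card S \<Longrightarrow>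
        (\<forall>x\<in>grid (?d * q + 1). \<bar>\<Sum>R\<in>S. \<gamma> R * box_zigzag (?d * q + 1) R x\<bar> \<le> H) \<Longrightarrow>
        c * sqrt (real q ^ ?d) \<le> H"
      using sb[OF q, of i0] by blast
    have size: "real q ^ (?d - 1) * 4 ^ (?d * q) \<le> 2 * real (card T)"
    proof -
      have "real (q ^ (?d - 1) * 4 ^ (?d * q)) \<le> real (2 * card T)"
        using T(2) unfolding card_boxes by (simp only: of_nat_le_iff)
      then show ?thesis by simp
    qed
    have big: "12 \<le> card T"
    proof -
      have "(1::nat) * 4 ^ 3 \<le> q ^ (?d - 1) * 4 ^ (?d * q)"
      proof (intro mult_mono power_increasing)
        show "3 \<le> ?d * q" using d q1 by (metis mult.right_neutral mult_le_mono)
      qed (use q1 in auto)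
      then show ?thesis using T(2) unfolding card_boxes by simp
    qed
    have sq: "sqrt (real q ^ ?d) = sqrt (real q) * sqrt (real q ^ (?d - 1))"
      using d by (simp add: real_sqrt_mult[symmetric] power_Suc[symmetric] del: power_Suc)
    have pos: "0 < sqrt (real q ^ (?d - 1))" using q1 by simp
    have \<epsilon>2: "\<epsilon> * B * sqrt (real q ^ (?d - 1)) * 4 ^ (?d * q) < c * sqrt (real q ^ ?d)"
    proof -
      have "\<epsilon> * B * 4 ^ (?d * q) < c * sqrt (real q)" using \<epsilon>(2) B by (simp add: field_simps)
      then have "\<epsilon> * B * 4 ^ (?d * q) * sqrt (real q ^ (?d - 1)) < c * sqrt (real q) * sqrt (real q ^ (?d - 1))"
        using pos by (rule mult_strict_right_mono)
      then show ?thesis unfolding sq by (simp add: mult_ac)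
    qed
    have "ereal (real (card T) / 4) \<le> ln_enat (covering_number \<epsilon> p TYPE('n))"
    proof (rule covering_number_ge)
      fix k :: nat and x
      assume cov: "(Ball_MW p :: (real ^ 'n \<Rightarrow> real) set) \<subseteq> (\<Union>m\<in>{1..k}. (\<lambda>b t. x m t + \<epsilon> * b t) ` B_inf)"
      have small: "\<exists>x\<in>grid (?d * q + 1). \<epsilon> * B * sqrt (real q ^ (?d - 1)) * 4 ^ (?d * q)
           < \<bar>\<Sum>R\<in>S. \<gamma> R * box_zigzag (?d * q + 1) R x\<bar>"
        if "S \<subseteq> T" "\<forall>R\<in>S. \<bar>\<gamma> R\<bar> = 1" "card T \<le> 16 * card S" for S \<gamma>
        using sbT[OF that] \<epsilon>2 by (meson not_le)
      show "0 < k \<and> real (card T) / 4 \<le> ln (real k)"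
        using ln_cover_size_ge[OF T(1) q1 B \<epsilon>(1) big good[OF q1 T(1)] small cov] by blast
    qed
    moreover have "ereal (real q ^ (?d - 1) * 4 ^ (?d * q) / 8) \<le> ereal (real (card T) / 4)"
      using size by simp
    ultimately show "ereal (real q ^ (?d - 1) * 4 ^ (?d * q) / 8) \<le> ln_enat (covering_number \<epsilon> p TYPE('n))"
      by (rule order.trans[rotated])
  qed
qed

lemma scale_for_epsilon:
  fixes f :: "nat \<Rightarrow> real"
  assumes "f \<longlonglongrightarrow> 0" "0 < \<epsilon>" "\<epsilon> < f q0"
  obtains q where "q0 \<le> q" "\<epsilon> < f q" "f (Suc q) \<le> \<epsilon>"
proof -
  have "\<forall>\<^sub>F q in sequentially. f q < \<epsilon>" using order_tendstoD(2)[OF assms(1,2)] .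
  then obtain Q where "\<And>q. Q \<le> q \<Longrightarrow> f q < \<epsilon>" by (auto simp: eventually_sequentially)
  then have ex: "f (q0 + Q) \<le> \<epsilon>" by (simp add: less_imp_le)
  \<comment> \<open>No monotonicity of \<open>f\<close> is assumed: \<open>q\<close> is taken just
    before the first index from \<open>q0\<close> on where \<open>f\<close> is at most
    \<epsilon>.\<close>
  define k where "k = (LEAST k. f (q0 + k) \<le> \<epsilon>)"
  have k: "f (q0 + k) \<le> \<epsilon>" unfolding k_def using ex by (rule LeastI)
  then obtain l where l: "k = Suc l" using assms(3) by (cases k) auto
  have "\<not> f (q0 + l) \<le> \<epsilon>" using not_less_Least[of l "\<lambda>k. f (q0 + k) \<le> \<epsilon>"] l by (simp add: k_def)
  then show ?thesis using that[of "q0 + l"] k l by simp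
qed

theorem theorem2p10:
  fixes p :: real
  assumes "1 \<le> p" and "CARD('n::finite) \<ge> 3"
  shows "\<exists>\<eta>>0. \<exists>c>0. \<exists>\<epsilon>\<^sub>0\<in>{0<..<1}. \<forall>\<epsilon>::real. 0 < \<epsilon> \<and> \<epsilon> < \<epsilon>\<^sub>0 \<longrightarrow>
           ln_enat (covering_number \<epsilon> p TYPE('n))
             \<ge> ereal (c * (1 / \<epsilon>) * ln (1 / \<epsilon>) powr (real CARD('n) - 1 + \<eta>))"
proof -
  let ?d = "CARD('n)"
  obtain a q0 where a: "0 < a" "1 \<le> q0" and
    low: "\<And>q \<epsilon>. q0 \<le> q \<Longrightarrow> 0 < \<epsilon> \<Longrightarrow> \<epsilon> < a * sqrt (real q) / 4 ^ (?d * q) \<Longrightarrow>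
       ereal (real q ^ (?d - 1) * 4 ^ (?d * q) / 8) \<le> ln_enat (covering_number \<epsilon> p TYPE('n))"
    using covering_number_at_scale[OF assms] by blast
  define f where "f = (\<lambda>q. a * sqrt (real q) / 4 ^ (?d * q))"
  have f0: "f \<longlonglongrightarrow> 0"
  proof (rule tendsto_sandwich[OF _ _ tendsto_const])
    show "\<forall>\<^sub>F q in sequentially. 0 \<le> f q" using a by (simp add: f_def)
    show "\<forall>\<^sub>F q in sequentially. f q \<le> a * (1 / 2) ^ q"
    proof (intro always_eventually allI)
      fix q :: nat
      have "sqrt (real q) \<le> 2 ^ q"
      proof (cases "q = 0")
        case False
        then have "sqrt (real q) \<le> real q" by (intro real_le_lsqrt) (auto simp: power2_eq_square)
        also have "\<dots> \<le> 2 ^ q" using less_exp[of q] by (metis less_imp_le of_nat_less_iff of_nat_numeral of_nat_power)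
        finally show ?thesis .
      qed simp
      moreover have "(4::real) ^ q \<le> 4 ^ (?d * q)" using assms(2) by (intro power_increasing) auto
      ultimately have "sqrt (real q) / 4 ^ (?d * q) \<le> 2 ^ q / 4 ^ q" by (intro frac_le) auto
      also have "(2::real) ^ q / 4 ^ q = (1 / 2) ^ q" by (simp add: power_divide[symmetric])
      finally have "a * (sqrt (real q) / 4 ^ (?d * q)) \<le> a * (1 / 2) ^ q" using a by (intro mult_left_mono) auto
      then show "f q \<le> a * (1 / 2) ^ q" by (simp add: f_def)
    qed
    show "(\<lambda>q. a * (1 / 2 :: real) ^ q) \<longlonglongrightarrow> 0"
      by (intro tendsto_mult_right_zero LIMSEQ_power_zero) simp
  qed
  define e :: real where "e = real ?d - 1 + 1 / 2"
  \<comment> \<open>Chosen for \<open>ln (1 / \<epsilon>) \<le> K * q\<close>: since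
    \<open>q >= 1\<close>, the constant term is absorbed, and the absolute value covers either sign
    of the logarithm.\<close>
  define K where "K = \<bar>ln (4 ^ ?d / a)\<bar> + real ?d * ln 4"
  have K: "0 < K" using assms(2) by (auto simp: K_def intro: add_nonneg_pos)
  \<comment> \<open>The denominators undo the 8 in \<open>low\<close>, the passage from scale
    \<open>q + 1\<close> to \<open>q\<close>, and the powers of \<open>K\<close>.\<close>
  define c where "c = a / (8 * 4 ^ ?d * K powr e)"
  have c: "0 < c" using a K by (simp add: c_def)
  have e0: "0 \<le> e" using assms(2) by (simp add: e_def)
  have bound: "ereal (c * (1 / \<epsilon>) * ln (1 / \<epsilon>) powr e) \<le> ln_enat (covering_number \<epsilon> p TYPE('n))"
    if \<epsilon>: "0 < \<epsilon>" "\<epsilon> < min (1 / 2) (f q0)" for \<epsilon>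
  proof -
    obtain q where q: "q0 \<le> q" "\<epsilon> < f q" "f (Suc q) \<le> \<epsilon>"
      using scale_for_epsilon[OF f0 \<epsilon>(1), of q0] \<epsilon>(2) by auto
    have q1: "1 \<le> q" using q a by linarith
    \<comment> \<open>The scale is discrete, but \<epsilon> lies above the next threshold, so
      \<open>1 / \<epsilon>\<close> is overestimated only by the constant
      \<open>4 ^ d\<close>.\<close>
    have lo: "a * sqrt (real q) / (4 ^ ?d * 4 ^ (?d * q)) \<le> \<epsilon>"
    proof -
      have "a * sqrt (real q) / (4 ^ ?d * 4 ^ (?d * q)) \<le> f (Suc q)"
        unfolding f_def using a by (simp add: power_add divide_right_mono)
      then show ?thesis using q(3) by linarith
    qed
    have pos: "0 < a * sqrt (real q) / (4 ^ ?d * 4 ^ (?d * q))" using a q1 by simp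
    have inv: "1 / \<epsilon> \<le> 4 ^ ?d * 4 ^ (?d * q) / (a * sqrt (real q))"
      using le_imp_inverse_le[OF lo pos] by (simp add: inverse_eq_divide)
    have "ln (1 / \<epsilon>) \<le> ln (4 ^ ?d / a * 4 ^ (?d * q))"
    proof (rule ln_mono)
      have "4 ^ ?d * 4 ^ (?d * q) / (a * sqrt (real q)) \<le> 4 ^ ?d * 4 ^ (?d * q) / (a * 1)"
        using a q1 by (intro divide_left_mono mult_left_mono mult_pos_pos) auto
      then show "1 / \<epsilon> \<le> 4 ^ ?d / a * 4 ^ (?d * q)" using inv by simp
    qed (use \<epsilon> a in auto)
    also have "\<dots> = ln (4 ^ ?d / a) + real (?d * q) * ln 4"
      using a by (subst ln_mult) (auto simp: ln_realpow)
    also have "\<dots> \<le> \<bar>ln (4 ^ ?d / a)\<bar> * real q + real (?d * q) * ln 4"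
    proof -
      have "\<bar>ln (4 ^ ?d / a)\<bar> * 1 \<le> \<bar>ln (4 ^ ?d / a)\<bar> * real q" using q1 by (intro mult_left_mono) auto
      then show ?thesis by linarith
    qed
    also have "\<dots> = K * real q" by (simp add: K_def algebra_simps)
    finally have lnle: "ln (1 / \<epsilon>) \<le> K * real q" .
    have "0 \<le> ln (1 / \<epsilon>)" using \<epsilon> by simp
    then have "ln (1 / \<epsilon>) powr e \<le> (K * real q) powr e" using lnle e0 by (intro powr_mono2)
    also have "\<dots> = K powr e * real q powr e" using K by (simp add: powr_mult)
    finally have pw: "ln (1 / \<epsilon>) powr e \<le> K powr e * real q powr e" .
    \<comment> \<open>The factor \<open>sqrt q\<close> in this power cancels the one in the
      denominator of the bound for \<open>1 / \<epsilon>\<close>; this fixes \<eta> = 1/2.\<close>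
    have qe: "real q powr e = real q ^ (?d - 1) * sqrt (real q)"
    proof -
      have "real q powr e = real q powr (real (?d - 1)) * real q powr (1 / 2)"
        unfolding e_def using assms(2) by (simp add: powr_add[symmetric] of_nat_diff)
      also have "real q powr (real (?d - 1)) = real q ^ (?d - 1)" using q1 by (intro powr_realpow) auto
      also have "real q powr (1 / 2) = sqrt (real q)" by (rule powr_half_sqrt) simp
      finally show ?thesis .
    qed
    have "c * (1 / \<epsilon>) * ln (1 / \<epsilon>) powr e
        \<le> c * (4 ^ ?d * 4 ^ (?d * q) / (a * sqrt (real q))) * (K powr e * (real q ^ (?d - 1) * sqrt (real q)))"
      using inv pw c a q1 \<epsilon>(1) unfolding qe by (intro mult_mono) auto
    also have "\<dots> = real q ^ (?d - 1) * 4 ^ (?d * q) / 8"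
      using a K q1 by (simp add: c_def field_simps)
    finally have "ereal (c * (1 / \<epsilon>) * ln (1 / \<epsilon>) powr e) \<le> ereal (real q ^ (?d - 1) * 4 ^ (?d * q) / 8)" by simp
    also have "\<dots> \<le> ln_enat (covering_number \<epsilon> p TYPE('n))"
      by (rule low[OF q(1) \<epsilon>(1)]) (use q(2) in \<open>simp add: f_def\<close>)
    finally show ?thesis .
  qed
  have "0 < f q0" using a by (simp add: f_def)
  then have "min (1 / 2) (f q0) \<in> {0<..<1}" by (auto simp: min_def)
  then show ?thesis using bound c unfolding e_def by (intro exI[of _ "1 / 2"] conjI exI[of _ c] bexI[of _ "min (1 / 2) (f q0)"]) auto
qed

end
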